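(* Let $d>0$, $\psi\in(0,\pi/2)$ and a positive integer $c$ be given. Set $r=\frac{d}{1+\cos\psi}$ and $R=r\sin\psi$ (so that $\psi=\arccos\frac{d^2-R^2}{d^2+R^2}$, $R<d$ and $r=\frac{R^2+d^2}{2d}$). Let $\nu$ be the closed planar curve that starts at $(2r,0)$ and traverses $c$ times, counterclockwise, the bigon in the disc $D_R(d,0)$ with vertices $q_0=(d,R)$ and $q_1=(d,-R)$ whose sides are the arc through $(2r,0)$ of the circle of radius $r$ centered at $(r,0)$, and the arc through $(2d-2r,0)$ of the circle of radius $r$ centered at $(2d-r,0)$. Let $H$ be the area bounded by $\nu$ (counted with multiplicity $c$). Let $\gamma_{d,R,c}$ be the closed curve obtained by concatenating the horizontal lift of $\nu$ to $(\mathbb R^3,\xi_{\mathrm{std}})$ with initial point $(2r,0,0)$ (which ends at $(2r,0,H)$) with its reversal. Then, for $\psi$ sufficiently close to $\pi/2$, the curve $\gamma_{d,R,c}$ is a periodic orbit in the table $D_R(d,0)\times[0,H]$ with $2+2c$ bounces. Numerical computation shows that "sufficiently close to $\pi/2$" contains the interval $\psi\in[0.909324\approx0.289447\pi,\ \pi/2)$.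
   Context: On $\mathbb R^3$ let $\alpha=dz-\tfrac12(x\,dy-y\,dx)=dz-\tfrac12r^2d\theta$ (in this formula $r,\theta$ are polar coordinates), $\xi_{\mathrm{std}}=\ker\alpha$, and $g_{\mathrm{std}}=dx^2+dy^2$ restricted to $\xi_{\mathrm{std}}$. Horizontal curves (tangent to $\xi_{\mathrm{std}}$) are determined by their projection to the $(x,y)$-plane and an initial height via $dz=\frac12(x\,dy-y\,dx)$. $D_R(d,0)$ is the closed planar disc of radius $R$ centered at $(d,0)$. Write covectors as $\lambda=a\alpha+b\,dx+c'\,dy$; the dual norm is $\sqrt{b^2+c'^2}$ and $S=\{b^2+c'^2=1\}$. Geodesics parametrised by arclength are projections of Hamiltonian orbits of the dual norm in $S$; $a$ is constant along them, $(b,c')$ is the velocity of the planar projection, which is a circular arc of curvature $a$. A billiard trajectory in a table $W\subset\mathbb R^3$ (here with piecewise smooth boundary: vertical wall, top and bottom) is a curve in $W$, parametrised by arclength, consisting of geodesic segments between reflection points on $\partial W$, such that at each reflection point $q$ the ingoing and outgoing momenta $\lambda_{\rm in}\ne\lambda_{\rm out}\in S\cap T_q^*\mathbb R^3$ satisfy $\lambda_{\rm in}-\lambda_{\rm out}\in\mathrm{Ann}(T_q\partial W)$. A periodic orbit is a periodic billiard trajectory, and its bounces are its reflection points on the boundary: one on the top, one on the bottom, and $2c$ on the vertical wall.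
   Formalization: The endpoint 0.909324 is read as rounded: the interval is [ψ0, π/2) for some ψ0 within 0.0000005 of 0.909324 with ψ0/π within 0.0000005 of 0.289447, since at exactly 0.909324 the curve dips just below the table (critical angle 0.909324014...). *)

theory Defs
  imports "HOL-Analysis.Analysis" "HOL-Library.Real_Mod"
begin

section \<open>The sub-Riemannian contact structure on 3-space\<close>

type_synonym plane = "real \<times> real"

text \<open>A point of 3-space is \<open>((x, y), z)\<close>. The same type serves for tangent vectors and for covectors
  (in the basis \<open>dx, dy, dz\<close>), the pairing of a covector with a vector being \<open>\<bullet>\<close>.\<close>

type_synonym space = "plane \<times> real"

definition cdx :: space where "cdx = ((1, 0), 0)"
definition cdy :: space where "cdy = ((0, 1), 0)"
definition cdz :: space where "cdz = ((0, 0), 1)"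

definition alpha :: "space \<Rightarrow> space" where
  "alpha q = (case q of ((x, y), z) \<Rightarrow> cdz - (1/2) *\<^sub>R (x *\<^sub>R cdy - y *\<^sub>R cdx))"

definition xi_std :: "space \<Rightarrow> space set" where
  "xi_std q = {v. alpha q \<bullet> v = 0}"

definition g_std :: "space \<Rightarrow> space \<Rightarrow> real" where
  "g_std v w = (cdx \<bullet> v) * (cdx \<bullet> w) + (cdy \<bullet> v) * (cdy \<bullet> w)"

definition dual_norm :: "space \<Rightarrow> space \<Rightarrow> real" where
  "dual_norm q p = Sup {p \<bullet> v | v. v \<in> xi_std q \<and> g_std v v \<le> 1}"

lemma dual_norm_eq: "dual_norm q (a *\<^sub>R alpha q + b *\<^sub>R cdx + c *\<^sub>R cdy) = sqrt (b\<^sup>2 + c\<^sup>2)"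
proof -
  obtain x y z where q: "q = ((x, y), z)" by (metis prod.exhaust)
  define P where "P = a *\<^sub>R alpha q + b *\<^sub>R cdx + c *\<^sub>R cdy"
  let ?A = "{P \<bullet> v | v. v \<in> xi_std q \<and> g_std v v \<le> 1}"
  let ?s = "sqrt (b\<^sup>2 + c\<^sup>2)"
  have P: "P \<bullet> v = b * fst (fst v) + c * snd (fst v)" if "v \<in> xi_std q" for v
  proof -
    have "P \<bullet> v = a * (alpha q \<bullet> v) + b * (cdx \<bullet> v) + c * (cdy \<bullet> v)"
      by (simp add: P_def inner_add_left)
    then show ?thesis using that by (simp add: xi_std_def) (simp add: cdx_def cdy_def inner_prod_def)
  qed
  have up: "u \<le> ?s" if "u \<in> ?A" for u
  proof -
    obtain v where v: "v \<in> xi_std q" "g_std v v \<le> 1" "u = P \<bullet> v" using \<open>u \<in> ?A\<close> by blast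
    have "u = (b, c) \<bullet> fst v" unfolding v(3) P[OF v(1)] by (simp add: inner_prod_def)
    also have "\<dots> \<le> norm (b, c) * norm (fst v)" by (rule norm_cauchy_schwarz)
    also have "\<dots> \<le> norm (b, c) * 1"
      using v(2) by (intro mult_left_mono)
        (auto simp: norm_prod_def g_std_def cdx_def cdy_def inner_prod_def power2_eq_square)
    finally show ?thesis by (simp add: norm_prod_def)
  qed
  have wit: "?s \<in> ?A"
  proof (cases "?s = 0")
    case True
    have "(0::space) \<in> xi_std q" by (simp add: xi_std_def)
    moreover have "P \<bullet> 0 = ?s" using True by simp
    ultimately show ?thesis
      by (intro CollectI exI[of _ 0]) (auto simp: g_std_def)
  next
    case False
    define v :: space where "v = ((b / ?s, c / ?s), (x * (c / ?s) - y * (b / ?s)) / 2)"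
    have s2: "?s * ?s = b * b + c * c" by (simp add: power2_eq_square)
    have v: "v \<in> xi_std q"
      by (simp add: xi_std_def v_def q alpha_def cdx_def cdy_def cdz_def inner_prod_def field_simps)
    have "b * b / (?s * ?s) + c * c / (?s * ?s) = 1"
      unfolding add_divide_distrib[symmetric] s2[symmetric] using False by simp
    then have "g_std v v = 1"
      by (simp add: g_std_def v_def cdx_def cdy_def inner_prod_def)
    moreover have "P \<bullet> v = (?s * ?s) / ?s" unfolding P[OF v] s2 by (simp add: v_def add_divide_distrib)
    then have "?s = P \<bullet> v" unfolding nonzero_mult_div_cancel_right[OF False] by (rule sym)
    ultimately show ?thesis using v by (intro CollectI exI[of _ v] conjI) simp_all
  qed
  show ?thesis unfolding dual_norm_def P_def[symmetric]
    using wit up by (intro cSup_eq_maximum) auto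
qed

definition unit_covectors :: "space \<Rightarrow> space set" where
  "unit_covectors q = {p. dual_norm q p = 1}"

text \<open>Hamilton's equations for the dual norm: the derivative of \<open>dual_norm\<close> on the cotangent bundle is
  the symplectic pairing with \<open>(q', p')\<close>, i.e. \<open>q' = \<partial>H/\<partial>p\<close> and \<open>p' = -\<partial>H/\<partial>q\<close>.\<close>

definition hamilton_eq_at :: "(real \<Rightarrow> space) \<Rightarrow> (real \<Rightarrow> space) \<Rightarrow> real \<Rightarrow> bool" where
  "hamilton_eq_at q p t \<longleftrightarrow>
     (\<exists>q' p'. (q has_vector_derivative q') (at t) \<and> (p has_vector_derivative p') (at t) \<and>
        ((\<lambda>(x, k). dual_norm x k) has_derivative (\<lambda>(u, w). q' \<bullet> w - p' \<bullet> u)) (at (q t, p t)))"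

section \<open>Billiard trajectories\<close>

definition tangent_vectors :: "space set \<Rightarrow> space \<Rightarrow> space set" where
  "tangent_vectors M q =
     {v. \<exists>\<sigma>. \<sigma> 0 = q \<and> (\<forall>\<^sub>F s in nhds (0::real). \<sigma> s \<in> M) \<and> (\<sigma> has_vector_derivative v) (at 0)}"

definition Ann :: "space set \<Rightarrow> space set" where
  "Ann V = {p. \<forall>v\<in>V. p \<bullet> v = 0}"

text \<open>A tangent plane exists at \<open>q\<close>; for a solid cylinder this excludes precisely the boundary points
  where the wall meets the top or the bottom (there the tangent vectors form a line).\<close>

definition smooth_boundary_point :: "space set \<Rightarrow> space \<Rightarrow> bool" where
  "smooth_boundary_point W q \<longleftrightarrow> q \<in> frontier W \<and>
     subspace (tangent_vectors (frontier W) q) \<and> dim (tangent_vectors (frontier W) q) = 2"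

text \<open>\<open>T\<close> is the set of reflection times and \<open>p\<close> the momentum along the curve. The projection of a
  Hamiltonian orbit in the unit covectors is automatically parametrised by arclength. The curve determines
  its momentum off \<open>T\<close>, and \<open>T\<close> is then the set of times at which the momentum jumps; so \<open>T\<close> is determined
  by the curve.\<close>

definition billiard_trajectory :: "space set \<Rightarrow> (real \<Rightarrow> space) \<Rightarrow> real set \<Rightarrow> bool" where
  "billiard_trajectory W \<gamma> T \<longleftrightarrow>
     continuous_on UNIV \<gamma> \<and> range \<gamma> \<subseteq> W \<and> (\<forall>a b. finite (T \<inter> {a..b})) \<and>
     (\<exists>p. (\<forall>t. t \<notin> T \<longrightarrow> p t \<in> unit_covectors (\<gamma> t) \<and> hamilton_eq_at \<gamma> p t) \<and>
          (\<forall>t\<in>T. smooth_boundary_point W (\<gamma> t) \<and>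
             (\<exists>lin lout. (p \<longlongrightarrow> lin) (at_left t) \<and> (p \<longlongrightarrow> lout) (at_right t) \<and>
                lin \<noteq> lout \<and> lin \<in> unit_covectors (\<gamma> t) \<and> lout \<in> unit_covectors (\<gamma> t) \<and>
                lin - lout \<in> Ann (tangent_vectors (frontier W) (\<gamma> t)))))"

definition periodic_orbit :: "space set \<Rightarrow> (real \<Rightarrow> space) \<Rightarrow> real set \<Rightarrow> bool" where
  "periodic_orbit W \<gamma> T \<longleftrightarrow> billiard_trajectory W \<gamma> T \<and> (\<exists>P>0. \<forall>t. \<gamma> (t + P) = \<gamma> t)"

definition cyl_table :: "real \<Rightarrow> real \<Rightarrow> real \<Rightarrow> space set" where
  "cyl_table d R H = cball (d, 0) R \<times> {0..H}"

section \<open>The curves\<close>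

definition arc_rad :: "real \<Rightarrow> real \<Rightarrow> real" where
  "arc_rad d \<psi> = d / (1 + cos \<psi>)"

definition disc_rad :: "real \<Rightarrow> real \<Rightarrow> real" where
  "disc_rad d \<psi> = arc_rad d \<psi> * sin \<psi>"

text \<open>One counterclockwise lap of the bigon, parametrised by arclength on \<open>[0, 4 r \<psi>]\<close>. The sides have
  angular size \<open>2 \<psi>\<close> about their centres; the left one runs from angle \<open>\<pi> - \<psi>\<close> to \<open>\<pi> + \<psi>\<close>.\<close>

definition bigon :: "real \<Rightarrow> real \<Rightarrow> real \<Rightarrow> plane" where
  "bigon d \<psi> t = (let r = arc_rad d \<psi> in
     if t \<le> r * \<psi> then (r, 0) + r *\<^sub>R (cos (t / r), sin (t / r))
     else if t \<le> 3 * r * \<psi> then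
       (2 * d - r, 0) + r *\<^sub>R (cos (pi - 2 * \<psi> + t / r), sin (pi - 2 * \<psi> + t / r))
     else (r, 0) + r *\<^sub>R (cos (t / r - 4 * \<psi>), sin (t / r - 4 * \<psi>)))"

definition lap :: "real \<Rightarrow> real \<Rightarrow> real" where
  "lap d \<psi> = 4 * arc_rad d \<psi> * \<psi>"

lemma bigon_corners:
  assumes "0 < d" "0 < \<psi>" "\<psi> < pi / 2"
  defines "r \<equiv> arc_rad d \<psi>" and "R \<equiv> disc_rad d \<psi>"
  shows "bigon d \<psi> 0 = (2 * r, 0)" "bigon d \<psi> (r * \<psi>) = (d, R)" "bigon d \<psi> (2 * r * \<psi>) = (2 * d - 2 * r, 0)"
    "bigon d \<psi> (3 * r * \<psi>) = (d, - R)" "bigon d \<psi> (lap d \<psi>) = (2 * r, 0)"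
proof -
  have c: "0 < cos \<psi>" using assms by (intro cos_gt_zero_pi) auto
  then have r: "0 < r" using assms by (simp add: r_def arc_rad_def)
  have d: "d = r + r * cos \<psi>" using c proof -
    have "r * (1 + cos \<psi>) = d" using c by (simp add: r_def arc_rad_def)
    then show ?thesis by (simp add: distrib_left)
  qed
  have R: "R = r * sin \<psi>" by (simp add: R_def r_def disc_rad_def)
  have \<pi>: "pi - 2 * \<psi> + 2 * \<psi> = pi" "pi - 2 * \<psi> + 3 * \<psi> = \<psi> + pi" by simp_all
  note b = bigon_def[of d \<psi>, folded r_def, unfolded Let_def]
  show "bigon d \<psi> 0 = (2 * r, 0)" using r assms(2) by (simp add: b)
  show "bigon d \<psi> (r * \<psi>) = (d, R)" unfolding R using r d[symmetric] by (simp add: b)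
  have "\<not> 2 * r * \<psi> \<le> r * \<psi>" "2 * r * \<psi> \<le> 3 * r * \<psi>" "2 * r * \<psi> / r = 2 * \<psi>" using r assms(2) by simp_all
  then show "bigon d \<psi> (2 * r * \<psi>) = (2 * d - 2 * r, 0)" by (simp only: b if_False if_True \<pi>) simp
  have "\<not> 3 * r * \<psi> \<le> r * \<psi>" "3 * r * \<psi> / r = 3 * \<psi>" using r assms(2) by simp_all
  moreover have "2 * d - r - r * cos \<psi> = d" using d by linarith
  ultimately show "bigon d \<psi> (3 * r * \<psi>) = (d, - R)" unfolding R by (simp only: b if_False if_True order_refl \<pi>) simp
  have "\<not> 4 * r * \<psi> \<le> r * \<psi>" "\<not> 4 * r * \<psi> \<le> 3 * r * \<psi>" "4 * r * \<psi> / r = 4 * \<psi>" using r assms(2) by simp_all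
  then show "bigon d \<psi> (lap d \<psi>) = (2 * r, 0)"
    unfolding lap_def r_def[symmetric] by (simp only: b if_False) simp
qed

text \<open>The bigon traversed for ever; \<open>\<nu>\<close> is the restriction to \<open>[0, c * lap]\<close>.\<close>

definition nu :: "real \<Rightarrow> real \<Rightarrow> real \<Rightarrow> plane" where
  "nu d \<psi> t = bigon d \<psi> (t rmod lap d \<psi>)"

definition bounded_area :: "real \<Rightarrow> real \<Rightarrow> nat \<Rightarrow> real" where
  "bounded_area d \<psi> c = real c * measure lebesgue (inside (bigon d \<psi> ` {0..lap d \<psi>}))"

text \<open>Horizontal lift with initial height \<open>z0\<close>, by \<open>dz = (x dy - y dx) / 2\<close>; the derivative of \<open>f\<close> may fail to
  exist at finitely many times.\<close>

definition hlift :: "(real \<Rightarrow> plane) \<Rightarrow> real \<Rightarrow> real \<Rightarrow> space" where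
  "hlift f z0 t = (f t, z0 + integral {0..t} (\<lambda>s. case (f s, vector_derivative f (at s)) of
     ((x, y), (x', y')) \<Rightarrow> (x * y' - y * x') / 2))"

text \<open>The curve \<open>f\<close> on \<open>[0, L]\<close> followed by its reversal, extended to a \<open>2 L\<close>-periodic curve.\<close>

definition there_and_back :: "real \<Rightarrow> (real \<Rightarrow> space) \<Rightarrow> real \<Rightarrow> space" where
  "there_and_back L f t = (let s = t rmod (2 * L) in if s \<le> L then f s else f (2 * L - s))"

definition gamma_orbit :: "real \<Rightarrow> real \<Rightarrow> nat \<Rightarrow> real \<Rightarrow> space" where
  "gamma_orbit d \<psi> c = there_and_back (real c * lap d \<psi>) (hlift (nu d \<psi>) 0)"

text \<open>Bounces are points of the boundary: along the reversal the curve reflects at the same points again.\<close>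

definition gamma_is_periodic_orbit :: "real \<Rightarrow> real \<Rightarrow> nat \<Rightarrow> bool" where
  "gamma_is_periodic_orbit d \<psi> c \<longleftrightarrow>
     (let R = disc_rad d \<psi>; H = bounded_area d \<psi> c; \<gamma> = gamma_orbit d \<psi> c in
      \<exists>T. periodic_orbit (cyl_table d R H) \<gamma> T \<and>
          card (\<gamma> ` T) = 2 + 2 * c \<and>
          card {q \<in> \<gamma> ` T. snd q = H} = 1 \<and>
          card {q \<in> \<gamma> ` T. snd q = 0} = 1 \<and>
          card {q \<in> \<gamma> ` T. fst q \<in> sphere (d, 0) R} = 2 * c)"

text \<open>The lift stays in \<open>0 \<le> z \<le> H\<close> iff \<open>3 \<psi> \<ge> sin \<psi> + 2 sin (2 \<psi>)\<close>, with critical angle \<open>0.909324014...\<close>.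
  Thus a printed endpoint \<open>0.909324\<close> has to be read as rounded: taken literally it lies just below the
  critical angle.\<close>

end

theory Submission
  imports Defs
begin

text \<open>Number the sides of the bigon along the curve by the integers: side \<open>n\<close> is an arc of angle \<open>2 \<psi>\<close> about its
  midpoint, and the sign \<open>(-1)\<^sup>n\<close> turns the right side into the left one. The height of the lift is then explicit
  on every side, and the momentum of both sides has the same \<open>\<alpha>\<close>-component \<open>1 / r\<close>, so at a vertex of
  the bigon it jumps by a multiple of \<open>dy\<close>, the conormal of the wall. At \<open>(2 r, 0)\<close> the momentum is
  \<open>dz / r\<close>, so that running back amounts to reflecting at the bottom or at the top.

  What remains is that the lift stays in \<open>0 \<le> z \<le> H\<close> and that the vertices lie strictly inside. By the symmetry of the
  bigon only \<open>z \<ge> 0\<close> on the left side matters. There, for \<open>\<psi> < \<pi> / 3\<close>, the height decreases and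
  the condition is \<open>3 \<psi> > sin \<psi> + 2 sin (2 \<psi>)\<close> at the second vertex; for \<open>\<psi> \<ge> \<pi> / 3\<close> crude bounds suffice. The
  condition is monotone in \<open>\<psi>\<close> and holds at \<open>1063 / 1169 = 0.9093242...\<close>.\<close>

section \<open>Hamiltonian orbits and the boundary of a solid cylinder\<close>

text \<open>The height of the lift is the area swept out as seen from the origin. The circle
  carrying the right side passes through the origin, diametrically opposite to (2 r, 0). The left
  side faces the origin and is swept backwards near its midpoint, so that height is lost there. As
  \<psi> tends to \<pi> / 2 the bigon opens up to the full circle and the loss vanishes; for small
  \<psi> the loss would push the lift below the bottom within the first lap.

  The starting point is forced as well. A covector with \<alpha>-component 1 / r and planar velocity
  (b, c') has no dx and dy part exactly when (b, c') = (-y, x) / (2 r), and as the velocity has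
  length 1 this happens only at distance 2 r from the origin. Only at such a point does negating the
  momentum change it by a multiple of dz, the conormal of top and bottom.

  The obstacle is the gluing: the orbit is given by arcs, two directions of travel and a momentum
  with jumps. Each fact about it is therefore reduced to which arc it follows near a given time, on
  one side or on both.\<close>

lemma dual_norm_coords:
  "dual_norm ((x, y), z) ((u, v), a) = sqrt ((u - a * y / 2)\<^sup>2 + (v + a * x / 2)\<^sup>2)"
proof -
  have "((u, v), a) =
      a *\<^sub>R alpha ((x, y), z) + (u - a * y / 2) *\<^sub>R cdx + (v + a * x / 2) *\<^sub>R cdy"
    by (simp add: alpha_def cdx_def cdy_def cdz_def)
  then show ?thesis
    by (simp only: dual_norm_eq)
qed

text \<open>In the basis dx, dy, dz the covector \<open>a \<alpha> + b dx + c dy\<close> has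
  components \<open>b + a y / 2\<close>, \<open>c - a x / 2\<close>, \<open>a\<close>. Along an arc
  of curvature \<open>a\<close> the velocity turns by \<open>b' = - a c\<close>,
  \<open>c' = a b\<close>, and the drift of \<open>x\<close> and \<open>y\<close> cancels half of
  this; what remains is the derivative demanded of \<open>p\<close>. The radicand of the dual norm
  is 1 at \<open>(q t, p t)\<close>, so the root is differentiable there.\<close>

lemma hamilton_eqI:
  assumes q: "(q has_vector_derivative ((b, c), (x * c - y * b) / 2)) (at t)"
    and p: "(p has_vector_derivative ((- a * c / 2, a * b / 2), 0)) (at t)"
    and qt: "q t = ((x, y), z)" and pt: "p t = ((b + a * y / 2, c - a * x / 2), a)"
    and bc: "b\<^sup>2 + c\<^sup>2 = 1"
  shows "p t \<in> unit_covectors (q t) \<and> hamilton_eq_at q p t"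
proof -
  have "dual_norm =
      (\<lambda>q p. sqrt ((fst (fst p) - snd p * snd (fst q) / 2)\<^sup>2 + (snd (fst p) + snd p * fst (fst q) / 2)\<^sup>2))"
    by (intro ext) (metis dual_norm_coords prod.collapse)
  moreover have "((\<lambda>(q :: space, p :: space).
        sqrt ((fst (fst p) - snd p * snd (fst q) / 2)\<^sup>2 + (snd (fst p) + snd p * fst (fst q) / 2)\<^sup>2))
      has_derivative
        (\<lambda>(u, w). ((b, c), (x * c - y * b) / 2) \<bullet> w - ((- a * c / 2, a * b / 2), 0 :: real) \<bullet> u))
      (at (q t, p t))"
    unfolding case_prod_beta
    by (rule derivative_eq_intros refl | simp add: qt pt bc)+
       (auto simp: fun_eq_iff qt pt bc field_simps)
  ultimately have "((\<lambda>(q, p). dual_norm q p) has_derivative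
        (\<lambda>(u, w). ((b, c), (x * c - y * b) / 2) \<bullet> w - ((- a * c / 2, a * b / 2), 0 :: real) \<bullet> u))
      (at (q t, p t))"
    by (simp only:)
  then have "hamilton_eq_at q p t"
    unfolding hamilton_eq_at_def using q p
    by (intro exI[of _ "((b, c), (x * c - y * b) / 2)"] exI[of _ "((- a * c / 2, a * b / 2), 0)"] conjI)
  moreover have "p t \<in> unit_covectors (q t)"
    by (simp add: unit_covectors_def qt pt dual_norm_coords bc)
  ultimately show ?thesis by blast
qed

section \<open>Tangent planes of the solid cylinder\<close>

lemma frontier_cyl_table:
  "frontier (cyl_table d R H) = cball (d, 0) R \<times> {0..H} - ball (d, 0) R \<times> {0<..<H}"
  by (simp add: cyl_table_def frontier_def closure_Times interior_Times)

lemma has_real_derivative_comp_linear: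
  assumes "(\<sigma> has_vector_derivative v) (at t)" "bounded_linear f"
  shows "((\<lambda>s. f (\<sigma> s)) has_real_derivative f v) (at t)"
  using bounded_linear.has_vector_derivative[OF assms(2,1)]
  by (simp add: has_real_derivative_iff_has_vector_derivative)

lemma deriv_zero_if_locally_const:
  assumes "(f has_real_derivative D) (at t)" "\<forall>\<^sub>F s in nhds t. f s = k"
  shows "D = (0 :: real)"
proof -
  have "f t = k" using assms(2) by (rule eventually_nhds_x_imp_x)
  then have "((\<lambda>_. k) has_real_derivative D) (at t)"
    using assms DERIV_cong_ev[OF refl, of f "\<lambda>_. k" t D D] by simp
  then show ?thesis by (rule DERIV_unique) simp
qed

lemma isCont_eventually_mem:
  assumes "isCont f t" "open S" "f t \<in> S"
  shows "\<forall>\<^sub>F s in nhds t. f s \<in> S"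
proof -
  have "(f \<longlongrightarrow> f t) (nhds t)"
    using assms(1) by (simp add: isCont_def tendsto_at_iff_tendsto_nhds)
  then show ?thesis using assms(2,3) by (rule topological_tendstoD)
qed

text \<open>A curve in the frontier that starts on a lid inside the wall can change its height only
  after reaching the wall or the other lid; by continuity its height is locally constant.\<close>

lemma tangent_vectors_lid:
  assumes "(x, y) \<in> ball (d, 0) R" "0 < H" "z \<in> {0, H}"
  shows "tangent_vectors (frontier (cyl_table d R H)) ((x, y), z) = {v. cdz \<bullet> v = 0}"
proof (intro set_eqI iffI)
  fix v assume "v \<in> tangent_vectors (frontier (cyl_table d R H)) ((x, y), z)"
  then obtain \<sigma> where \<sigma>: "\<sigma> 0 = ((x, y), z)" "\<forall>\<^sub>F s in nhds (0::real). \<sigma> s \<in> frontier (cyl_table d R H)"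
    "(\<sigma> has_vector_derivative v) (at 0)" by (auto simp: tangent_vectors_def)
  have c: "isCont \<sigma> 0"
    using \<sigma>(3) by (rule has_vector_derivative_continuous)
  \<comment> \<open>The height of the opposite lid, for both values of \<open>z\<close> at
    once.\<close>
  define k where "k = H - z"
  have "open (ball (d, 0) R \<times> - {k})" by (intro open_Times) auto
  moreover have "\<sigma> 0 \<in> ball (d, 0) R \<times> - {k}" using assms by (auto simp: \<sigma>(1) k_def)
  ultimately have "\<forall>\<^sub>F s in nhds 0. \<sigma> s \<in> ball (d, 0) R \<times> - {k}"
    by (rule isCont_eventually_mem[OF c])
  with \<sigma>(2) have "\<forall>\<^sub>F s in nhds 0. snd (\<sigma> s) = z"
  proof eventually_elim
    case (elim s)
    then have "fst (\<sigma> s) \<in> ball (d,0) R" "snd (\<sigma> s) \<noteq> H - z" "0 \<le> snd (\<sigma> s)" "snd (\<sigma> s) \<le> H"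
      "\<not> (0 < snd (\<sigma> s) \<and> snd (\<sigma> s) < H)"
      by (cases "\<sigma> s"; force simp: frontier_cyl_table k_def)+
    then show ?case using assms(3) by auto
  qed
  then have "snd v = 0"
    using deriv_zero_if_locally_const has_real_derivative_comp_linear[OF \<sigma>(3) bounded_linear_snd] by blast
  then show "v \<in> {v. cdz \<bullet> v = 0}" by (cases v) (auto simp: cdz_def inner_prod_def)
next
  fix v assume "v \<in> {v. cdz \<bullet> v = 0}"
  then obtain a b where v: "v = ((a, b), 0)" by (cases v, cases "fst v") (auto simp: cdz_def inner_prod_def)
  define \<tau> where "\<tau> s = (x + s * a, y + s * b)" for s
  have "isCont \<tau> 0" unfolding \<tau>_def by (intro continuous_intros)
  moreover have "\<tau> 0 \<in> ball (d, 0) R" using assms by (simp add: \<tau>_def)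
  ultimately have "\<forall>\<^sub>F s in nhds 0. \<tau> s \<in> ball (d, 0) R"
    by (intro isCont_eventually_mem) auto
  then have "\<forall>\<^sub>F s in nhds 0. (\<tau> s, z) \<in> frontier (cyl_table d R H)"
    by eventually_elim (use assms in \<open>auto simp: frontier_cyl_table\<close>)
  moreover have "((\<lambda>s. (\<tau> s, z)) has_vector_derivative v) (at 0)"
    unfolding \<tau>_def v by (auto intro!: derivative_eq_intros has_vector_derivative_Pair)
  ultimately show "v \<in> tangent_vectors (frontier (cyl_table d R H)) ((x, y), z)"
    unfolding tangent_vectors_def by (intro CollectI exI[of _ "\<lambda>s. (\<tau> s, z)"]) (simp add: \<tau>_def)
qed

text \<open>Between the lids the frontier is a level set of the squared distance from the axis,
  whose differential at \<open>(d, \<epsilon> R)\<close> is a nonzero multiple of dy.\<close>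

lemma tangent_vectors_wall:
  assumes "0 < R" "\<epsilon> \<in> {1, -1}" "0 < z" "z < H"
  shows "tangent_vectors (frontier (cyl_table d R H)) ((d, \<epsilon> * R), z) = {v. cdy \<bullet> v = 0}"
proof (intro set_eqI iffI)
  fix v assume "v \<in> tangent_vectors (frontier (cyl_table d R H)) ((d, \<epsilon> * R), z)"
  then obtain \<sigma> where \<sigma>: "\<sigma> 0 = ((d, \<epsilon> * R), z)"
    "\<forall>\<^sub>F s in nhds (0::real). \<sigma> s \<in> frontier (cyl_table d R H)"
    "(\<sigma> has_vector_derivative v) (at 0)" by (auto simp: tangent_vectors_def)
  have c: "isCont \<sigma> 0"
    using \<sigma>(3) by (rule has_vector_derivative_continuous)
  have "open (UNIV \<times> {0<..<H} :: space set)" by (intro open_Times) auto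
  moreover have "\<sigma> 0 \<in> UNIV \<times> {0<..<H}" using assms by (auto simp: \<sigma>(1))
  ultimately have "\<forall>\<^sub>F s in nhds 0. \<sigma> s \<in> UNIV \<times> {0<..<H}"
    by (rule isCont_eventually_mem[OF c])
  with \<sigma>(2) have ev: "\<forall>\<^sub>F s in nhds 0. (fst (fst (\<sigma> s)) - d)\<^sup>2 + (snd (fst (\<sigma> s)))\<^sup>2 = R\<^sup>2"
  proof eventually_elim
    case (elim s)
    then have "dist (d, 0) (fst (\<sigma> s)) = R"
      by (cases "\<sigma> s") (auto simp: frontier_cyl_table)
    then have "(dist (d, 0) (fst (\<sigma> s)))\<^sup>2 = R\<^sup>2" by simp
    then show ?case by (cases "fst (\<sigma> s)") (simp add: dist_prod_def dist_real_def power2_commute)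
  qed
  have 1: "((\<lambda>s. fst (fst (\<sigma> s))) has_real_derivative fst (fst v)) (at 0)"
    "((\<lambda>s. snd (fst (\<sigma> s))) has_real_derivative snd (fst v)) (at 0)"
    by (rule has_real_derivative_comp_linear[OF \<sigma>(3)]; intro bounded_linear_intros)+
  have "((\<lambda>s. (fst (fst (\<sigma> s)) - d)\<^sup>2 + (snd (fst (\<sigma> s)))\<^sup>2) has_real_derivative
      2 * (\<epsilon> * R) * snd (fst v)) (at 0)"
    by (rule derivative_eq_intros 1 refl | simp add: \<sigma>(1))+
  from deriv_zero_if_locally_const[OF this ev] have "snd (fst v) = 0" using assms by auto
  then show "v \<in> {v. cdy \<bullet> v = 0}" by (cases v, cases "fst v") (auto simp: cdy_def inner_prod_def)
next
  fix v assume "v \<in> {v. cdy \<bullet> v = 0}"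
  then obtain a b where v: "v = ((a, 0), b)" by (cases v, cases "fst v") (auto simp: cdy_def inner_prod_def)
  \<comment> \<open>Turns round the wall with initial speed \<open>a\<close> and climbs with speed
    \<open>b\<close>, which realises every vector without dy part.\<close>
  define \<tau> where "\<tau> s = ((d + R * sin (s * a / R), \<epsilon> * R * cos (s * a / R)), z + s * b)" for s
  have "\<forall>\<^sub>F s in nhds 0. z + s * b \<in> {0<..<H}"
    using assms by (intro isCont_eventually_mem) (auto intro!: continuous_intros)
  then have "\<forall>\<^sub>F s in nhds 0. \<tau> s \<in> frontier (cyl_table d R H)"
  proof eventually_elim
    case (elim s)
    have "dist (d, 0) (fst (\<tau> s)) = sqrt ((R * sin (s * a / R))\<^sup>2 + (R * cos (s * a / R))\<^sup>2)"
      using assms(2) by (auto simp: \<tau>_def dist_prod_def dist_real_def)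
    also have "\<dots> = sqrt (R\<^sup>2 * ((sin (s * a / R))\<^sup>2 + (cos (s * a / R))\<^sup>2))"
      by (simp only: power_mult_distrib distrib_left)
    also have "\<dots> = R" using assms(1) by simp
    finally show ?case using elim by (auto simp: \<tau>_def frontier_cyl_table)
  qed
  moreover have "(\<tau> has_vector_derivative v) (at 0)"
  proof -
    have "((\<lambda>s. d + R * sin (s * a / R)) has_vector_derivative a) (at 0)"
      "((\<lambda>s. \<epsilon> * R * cos (s * a / R)) has_vector_derivative 0) (at 0)"
      "((\<lambda>s. z + s * b) has_vector_derivative b) (at 0)"
      unfolding has_real_derivative_iff_has_vector_derivative[symmetric]
      using assms(1) by (auto intro!: derivative_eq_intros)
    then show ?thesis unfolding \<tau>_def v by (intro has_vector_derivative_Pair)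
  qed
  ultimately show "v \<in> tangent_vectors (frontier (cyl_table d R H)) ((d, \<epsilon> * R), z)"
    unfolding tangent_vectors_def by (intro CollectI exI[of _ \<tau>]) (simp add: \<tau>_def)
qed

lemma smooth_boundary_pointI:
  assumes "q \<in> frontier W" "tangent_vectors (frontier W) q = {v. a \<bullet> v = 0}" "a \<noteq> 0"
  shows "smooth_boundary_point W q"
  using assms dim_hyperplane[OF assms(3)] by (simp add: smooth_boundary_point_def subspace_hyperplane)

section \<open>The area of a lens\<close>

lemma mem_ball_plane: "(x, y) \<in> ball (a, 0) r \<longleftrightarrow> (x - a)\<^sup>2 + y\<^sup>2 < r\<^sup>2"
  if "0 < r" for r x y a :: real
proof -
  have "dist (a, 0) (x, y) = sqrt ((x - a)\<^sup>2 + y\<^sup>2)"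
    by (simp add: dist_prod_def dist_real_def power2_commute)
  then show ?thesis using that by (simp add: real_sqrt_less_iff[of _ "r\<^sup>2", simplified, symmetric] del: real_sqrt_less_iff)
qed

lemma mem_cball_plane: "(x, y) \<in> cball (a, 0) r \<longleftrightarrow> (x - a)\<^sup>2 + y\<^sup>2 \<le> r\<^sup>2"
  if "0 < r" for r x y a :: real
proof -
  have "dist (a, 0) (x, y) = sqrt ((x - a)\<^sup>2 + y\<^sup>2)"
    by (simp add: dist_prod_def dist_real_def power2_commute)
  then show ?thesis using that by (simp add: real_sqrt_le_iff[of _ "r\<^sup>2", simplified, symmetric] del: real_sqrt_le_iff)
qed

text \<open>On the unit circle the inequality of the second disc becomes linear: because
  \<open>cos \<psi> > 0\<close>, it says \<open>X \<ge> cos \<psi>\<close>.\<close>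

lemma polar_bounded_angle:
  fixes X Y \<psi> :: real
  assumes "X\<^sup>2 + Y\<^sup>2 = 1" "0 < \<psi>" "\<psi> < pi / 2" "(X - 2 * cos \<psi>)\<^sup>2 + Y\<^sup>2 \<le> 1"
  obtains \<phi> where "\<bar>\<phi>\<bar> \<le> \<psi>" "X = cos \<phi>" "Y = sin \<phi>"
proof -
  obtain t where t: "0 \<le> t" "t \<le> pi" "X = cos t" "\<bar>Y\<bar> = sin t"
    using sincos_total_pi[of "\<bar>Y\<bar>" X] assms(1) by auto
  have c: "0 < cos \<psi>" using assms by (intro cos_gt_zero_pi) auto
  have "(X - 2 * cos \<psi>)\<^sup>2 + Y\<^sup>2 = 1 + 4 * (cos \<psi> * (cos \<psi> - X))"
    using assms(1) by (simp add: power2_eq_square algebra_simps)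
  then have "cos \<psi> * (cos \<psi> - X) \<le> 0" using assms(4) by simp
  then have "cos \<psi> \<le> cos t" using c t by (simp add: mult_le_0_iff)
  then have "t \<le> \<psi>" using cos_mono_le_eq[of \<psi> t] assms t by auto
  show ?thesis
  proof (cases "0 \<le> Y")
    case True then show ?thesis using t \<open>t \<le> \<psi>\<close> by (intro that[of t]) auto
  next
    case False then show ?thesis using t \<open>t \<le> \<psi>\<close> by (intro that[of "- t"]) auto
  qed
qed

text \<open>A boundary point lies on one of the circles and in the other disc. The point reflection
  in \<open>(r + r cos \<psi>, 0)\<close> exchanges the discs, so that both cases are instances of
  \<open>polar_bounded_angle\<close>, the second one for \<open>2 cos \<psi> - X\<close> and
  \<open>- Y\<close>.\<close>

lemma frontier_lens:
  fixes r \<psi> :: real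
  assumes "0 < r" "0 < \<psi>" "\<psi> < pi / 2"
  shows "frontier (cball (r, 0) r \<inter> cball (r + 2 * r * cos \<psi>, 0) r) =
    (\<lambda>\<phi>. (r + r * cos \<phi>, r * sin \<phi>)) ` {-\<psi>..\<psi>} \<union>
    (\<lambda>\<phi>. (r + 2 * r * cos \<psi> - r * cos \<phi>, - (r * sin \<phi>))) ` {-\<psi>..\<psi>}" (is "frontier ?K = ?A \<union> ?B")
proof -
  note mem = mem_ball_plane[OF assms(1)] mem_cball_plane[OF assms(1)]
  have fr: "frontier ?K = ?K - (ball (r, 0) r \<inter> ball (r + 2 * r * cos \<psi>, 0) r)"
    by (simp add: frontier_def closed_Int)
  have c0: "0 < cos \<psi>" using assms by (intro cos_gt_zero_pi) auto
  have far: "(r * cos \<phi> - 2 * r * cos \<psi>)\<^sup>2 + (r * sin \<phi>)\<^sup>2 \<le> r\<^sup>2" if "\<phi> \<in> {-\<psi>..\<psi>}" for \<phi>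
  proof -
    have "cos \<psi> \<le> cos \<bar>\<phi>\<bar>" using that assms by (intro cos_monotone_0_pi_le) auto
    then have "cos \<psi> * (cos \<psi> - cos \<phi>) \<le> 0" using c0 by (auto simp: mult_le_0_iff)
    then have "r\<^sup>2 * (1 + 4 * (cos \<psi> * (cos \<psi> - cos \<phi>))) \<le> r\<^sup>2 * 1" by (intro mult_left_mono) auto
    moreover have "(r * cos \<phi> - 2 * r * cos \<psi>)\<^sup>2 + (r * sin \<phi>)\<^sup>2 =
        r\<^sup>2 * (((cos \<phi>)\<^sup>2 + (sin \<phi>)\<^sup>2) + 4 * (cos \<psi> * (cos \<psi> - cos \<phi>)))"
      by algebra
    ultimately show ?thesis by simp
  qed
  have circ: "(r * cos \<phi>)\<^sup>2 + (r * sin \<phi>)\<^sup>2 = r\<^sup>2" for \<phi>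
  proof -
    have "(r * cos \<phi>)\<^sup>2 + (r * sin \<phi>)\<^sup>2 = r\<^sup>2 * ((cos \<phi>)\<^sup>2 + (sin \<phi>)\<^sup>2)" by algebra
    then show ?thesis by simp
  qed
  have "?A \<subseteq> frontier ?K"
    unfolding fr using far circ by (auto simp: mem simp del: mem_ball mem_cball)
  moreover have "?B \<subseteq> frontier ?K"
    unfolding fr using far circ by (auto simp: mem power2_commute[of "2 * r * cos \<psi>"] simp del: mem_ball mem_cball)
  moreover have "frontier ?K \<subseteq> ?A \<union> ?B"
  proof
    fix q assume q: "q \<in> frontier ?K"
    obtain x y where xy: "q = (x, y)" by (cases q)
    define X Y where "X = (x - r) / r" and "Y = y / r"
    have x: "x = r + r * X" "y = r * Y" using assms by (auto simp: X_def Y_def)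
    have 1: "(x - r)\<^sup>2 + y\<^sup>2 = r\<^sup>2 * (X\<^sup>2 + Y\<^sup>2)" unfolding x by algebra
    have 2: "(x - (r + 2 * r * cos \<psi>))\<^sup>2 + y\<^sup>2 = r\<^sup>2 * ((X - 2 * cos \<psi>)\<^sup>2 + Y\<^sup>2)" unfolding x by algebra
    have "X\<^sup>2 + Y\<^sup>2 \<le> 1" "(X - 2 * cos \<psi>)\<^sup>2 + Y\<^sup>2 \<le> 1"
      "\<not> (X\<^sup>2 + Y\<^sup>2 < 1 \<and> (X - 2 * cos \<psi>)\<^sup>2 + Y\<^sup>2 < 1)"
      using q assms unfolding fr xy Diff_iff Int_iff mem 1 2 by auto
    then consider "X\<^sup>2 + Y\<^sup>2 = 1" "(X - 2 * cos \<psi>)\<^sup>2 + Y\<^sup>2 \<le> 1" |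
        "(2 * cos \<psi> - X)\<^sup>2 + (- Y)\<^sup>2 = 1" "((2 * cos \<psi> - X) - 2 * cos \<psi>)\<^sup>2 + (- Y)\<^sup>2 \<le> 1"
      by (simp add: power2_commute[of X]) linarith
    then show "q \<in> ?A \<union> ?B"
    proof cases
      case 1
      then obtain \<phi> where "\<bar>\<phi>\<bar> \<le> \<psi>" "X = cos \<phi>" "Y = sin \<phi>" using polar_bounded_angle assms by blast
      then have "q \<in> ?A" unfolding xy x by (intro image_eqI[of _ _ \<phi>]) auto
      then show ?thesis ..
    next
      case 2
      then obtain \<phi> where \<phi>: "\<bar>\<phi>\<bar> \<le> \<psi>" "2 * cos \<psi> - X = cos \<phi>" "- Y = sin \<phi>"
        using polar_bounded_angle assms by blast
      then have XY: "X = 2 * cos \<psi> - cos \<phi>" "Y = - sin \<phi>" by auto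
      have "q \<in> ?B" unfolding xy x XY using \<phi>(1) by (intro image_eqI[of _ _ \<phi>]) (auto simp: algebra_simps)
      then show ?thesis ..
    qed
  qed
  ultimately show ?thesis by blast
qed

text \<open>Slices parallel to the x-axis have a single length formula on the whole lens. Here
  \<open>k\<close> is half the distance of the centres and \<open>R\<close> half the distance of the
  vertices.\<close>

lemma measure_lens:
  fixes r \<psi> :: real
  assumes "0 < r" "0 < \<psi>" "\<psi> < pi / 2"
  shows "measure lborel (ball (r, 0 :: real) r \<inter> ball (r + 2 * r * cos \<psi>, 0) r) = r\<^sup>2 * (2 * \<psi> - sin (2 * \<psi>))"
    (is "measure lborel ?U = _")
proof -
  define k where "k = r * cos \<psi>"
  define R where "R = r * sin \<psi>"
  have k0: "0 < k" unfolding k_def using assms by (intro mult_pos_pos cos_gt_zero_pi) auto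
  have R0: "0 < R" unfolding R_def using assms by (intro mult_pos_pos sin_gt_zero2) auto
  have kR: "k\<^sup>2 + R\<^sup>2 = r\<^sup>2"
    using sin_cos_squared_add2[of \<psi>] unfolding k_def R_def by algebra
  have Rr: "R < r" using kR assms(1) zero_less_power[OF k0, of 2] by (intro power2_less_imp_less[of R r]) linarith+
  have slice: "emeasure lborel ((\<lambda>x. (x, y)) -` ?U) =
      ennreal (2 * (sqrt (r\<^sup>2 - y\<^sup>2) - k)) * indicator {-R..R} y" for y :: real
  proof -
    \<comment> \<open>The real \<open>sqrt\<close> is odd and strictly increasing on the whole line,
      so this also holds for \<open>y\<^sup>2 > r\<^sup>2\<close>, where the right side is negative
      and the slice empty.\<close>
    have sq: "(x - a)\<^sup>2 + y\<^sup>2 < r\<^sup>2 \<longleftrightarrow> \<bar>x - a\<bar> < sqrt (r\<^sup>2 - y\<^sup>2)" for x a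
      using real_sqrt_less_iff[of "(x - a)\<^sup>2" "r\<^sup>2 - y\<^sup>2"] by auto
    have "(\<lambda>x. (x, y)) -` ?U = {r + 2 * k - sqrt (r\<^sup>2 - y\<^sup>2) <..< r + sqrt (r\<^sup>2 - y\<^sup>2)}"
      using k0 by (auto simp: mem_ball_plane[OF assms(1)] sq k_def mult.assoc simp del: mem_ball)
    moreover have "y \<in> {-R..R} \<longleftrightarrow> k \<le> sqrt (r\<^sup>2 - y\<^sup>2)"
    proof -
      have "k \<le> sqrt (r\<^sup>2 - y\<^sup>2) \<longleftrightarrow> sqrt (k\<^sup>2) \<le> sqrt (r\<^sup>2 - y\<^sup>2)" using k0 by simp
      also have "\<dots> \<longleftrightarrow> y\<^sup>2 \<le> R\<^sup>2" unfolding real_sqrt_le_iff using kR by auto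
      also have "\<dots> \<longleftrightarrow> \<bar>y\<bar> \<le> R" using R0 by (simp add: abs_le_square_iff[symmetric])
      finally show ?thesis by auto
    qed
    ultimately show ?thesis by (auto simp: indicator_def)
  qed
  \<comment> \<open>An antiderivative of the slice length: the first two summands have derivative
    \<open>2 * sqrt (r\<^sup>2 - y\<^sup>2)\<close>.\<close>
  define F where "F y = y * sqrt (r\<^sup>2 - y\<^sup>2) + r\<^sup>2 * arcsin (y / r) - 2 * k * y" for y
  have "?U \<in> sets borel" by (intro borel_open open_Int open_ball)
  then have meas: "?U \<in> sets (borel \<Otimes>\<^sub>M borel)" by (simp only: borel_prod)
  have "emeasure lborel ?U = (\<integral>\<^sup>+ y. emeasure lborel ((\<lambda>x. (x, y)) -` ?U) \<partial>lborel)"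
    unfolding lborel_prod[symmetric] by (intro lborel_pair.emeasure_pair_measure_alt2)
      (use meas in \<open>simp del: borel_prod\<close>)
  also have "\<dots> = (\<integral>\<^sup>+ y. ennreal (2 * (sqrt (r\<^sup>2 - y\<^sup>2) - k)) * indicator {-R..R} y \<partial>lborel)"
    unfolding slice ..
  also have "\<dots> = ennreal (F R - F (- R))"
  proof (rule nn_integral_FTC_Icc)
    fix y assume "y \<in> {-R..R}"
    then have y: "- R \<le> y" "y \<le> R" by auto
    have "y\<^sup>2 \<le> R\<^sup>2" using y R0 by (auto simp: abs_le_square_iff[symmetric])
    then have le: "k\<^sup>2 \<le> r\<^sup>2 - y\<^sup>2" using kR by simp
    define S where "S = sqrt (r\<^sup>2 - y\<^sup>2)"
    have "sqrt (k\<^sup>2) \<le> S" unfolding S_def using le by (rule real_sqrt_le_mono)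
    \<comment> \<open>As \<open>k > 0\<close>, the root stays positive up to the ends of the
      interval, so \<open>F\<close> is differentiable there too.\<close>
    then have S: "k \<le> S" "0 < S" using k0 by auto
    then show "0 \<le> 2 * (sqrt (r\<^sup>2 - y\<^sup>2) - k)" by (simp add: S_def)
    have S2: "S\<^sup>2 = r\<^sup>2 - y\<^sup>2" unfolding S_def using le by (meson real_sqrt_pow2 order_trans zero_le_power2)
    have pos: "0 < r\<^sup>2 - y\<^sup>2" using le k0 by (smt (verit) zero_less_power)
    have 1: "((\<lambda>y. sqrt (r\<^sup>2 - y\<^sup>2)) has_real_derivative - y / S) (at y)"
      using pos by (auto intro!: derivative_eq_intros simp: S_def field_simps)
    have "sqrt (1 - (y / r)\<^sup>2) = sqrt ((r\<^sup>2 - y\<^sup>2) / r\<^sup>2)"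
      using assms(1) by (simp add: field_simps)
    then have "sqrt (1 - (y / r)\<^sup>2) = S / r" using assms(1) by (simp add: S_def real_sqrt_divide)
    then have 2: "((\<lambda>y. arcsin (y / r)) has_real_derivative 1 / S) (at y)"
      using y Rr assms(1) S by (auto intro!: derivative_eq_intros simp: field_simps)
    have "1 * sqrt (r\<^sup>2 - y\<^sup>2) + - y / S * y + r\<^sup>2 * (1 / S) - 2 * k * 1 = 2 * (S - k)"
      unfolding S_def[symmetric] using S S2 by (simp add: field_simps power2_eq_square)
    with DERIV_diff[OF DERIV_add[OF DERIV_mult[OF DERIV_ident 1] DERIV_cmult[OF 2, of "r\<^sup>2"]]
        DERIV_cmult[OF DERIV_ident, of "2 * k"]]
    have "(F has_real_derivative 2 * (S - k)) (at y)"
      unfolding F_def by (simp only:)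
    then show "(F has_real_derivative 2 * (sqrt (r\<^sup>2 - y\<^sup>2) - k)) (at y)"
      unfolding S_def .
  qed (use R0 in auto)
  also have "F R - F (- R) = r\<^sup>2 * (2 * \<psi> - sin (2 * \<psi>))"
  proof -
    have "r\<^sup>2 - R\<^sup>2 = k\<^sup>2" using kR by simp
    moreover have "arcsin (R / r) = \<psi>" using assms by (simp add: R_def arcsin_sin)
    moreover from this have "arcsin (- (R / r)) = - \<psi>"
      using R0 Rr assms(1) arcsin_minus[of "R / r"] divide_pos_pos[OF R0 assms(1)] by simp
    ultimately have "F R - F (- R) = 2 * (R * k + r\<^sup>2 * \<psi> - 2 * k * R)"
      using k0 R0 Rr assms(1) by (simp add: F_def)
    then show ?thesis
      using sin_double[of \<psi>] by (simp add: k_def R_def power2_eq_square algebra_simps)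
  qed
  finally have "emeasure lborel ?U = ennreal (r\<^sup>2 * (2 * \<psi> - sin (2 * \<psi>)))" .
  moreover have "0 \<le> r\<^sup>2 * (2 * \<psi> - sin (2 * \<psi>))"
    using assms by (intro mult_nonneg_nonneg) (auto intro: sin_x_le_x)
  ultimately show ?thesis by (simp add: measure_def)
qed

section \<open>Numerical estimates\<close>

lemma sin_Maclaurin_lower: "(\<Sum>m<n. sin_coeff m * x ^ m) - inverse (fact n) * \<bar>x\<bar> ^ n \<le> sin x"
  and sin_Maclaurin_upper: "sin x \<le> (\<Sum>m<n. sin_coeff m * x ^ m) + inverse (fact n) * \<bar>x\<bar> ^ n"
  using Maclaurin_sin_bound[of x n] by linarith+

text \<open>Fractions with small denominators keep the exact evaluation of the Taylor polynomials cheap.\<close>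

lemma pi_bounds: "5658 / 1801 < pi" "pi < (355 / 113 :: real)"
proof -
  \<comment> \<open>The sign of the sine decides on which side of \<pi> a nearby fraction
    lies.\<close>
  have "0 < sin (5658 / 1801 :: real)"
    by (rule less_le_trans[OF _ sin_Maclaurin_lower[where n = 20]])
      (simp add: sin_coeff_def lessThan_nat_numeral fact_numeral power_divide)
  moreover have "sin (5658 / 1801 :: real) \<le> 0" if "pi \<le> 5658 / 1801"
    using that pi_gt3 by (intro sin_le_zero) simp_all
  ultimately show "5658 / 1801 < pi" by linarith
  have "sin (355 / 113 :: real) < 0"
    by (rule le_less_trans[OF sin_Maclaurin_upper[where n = 20]])
      (simp add: sin_coeff_def lessThan_nat_numeral fact_numeral power_divide)
  moreover have "0 \<le> sin (355 / 113 :: real)" if "355 / 113 \<le> pi"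
    using that by (intro sin_ge_zero) simp_all
  ultimately show "pi < 355 / 113" by linarith
qed

text \<open>The fraction has a small denominator and lies between the critical angle 0.909324014...
  and 0.9093245, the largest number within the rounding tolerance. It exceeds the critical angle by
  only about 2e-7, which leaves a positive value below 1e-6; hence sine bounds with seven
  decimals.\<close>

lemma critical_angle_bound:
  "0 < 3 * (1063 / 1169) - sin (1063 / 1169) - 2 * sin (2 * (1063 / 1169) :: real)"
proof -
  have "sin (1063 / 1169 :: real) < 0.7890888"
    by (rule le_less_trans[OF sin_Maclaurin_upper[where n = 14]])
      (simp add: sin_coeff_def lessThan_nat_numeral fact_numeral power_divide)
  moreover have "sin (2 * (1063 / 1169) :: real) < 0.9694416"
    by (rule le_less_trans[OF sin_Maclaurin_upper[where n = 18]])
      (simp add: sin_coeff_def lessThan_nat_numeral fact_numeral power_divide)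
  ultimately show ?thesis by simp
qed

text \<open>The derivative factors as \<open>(1 + cos x) * (7 - 8 * cos x)\<close>, so only
  \<open>cos x < 7 / 8\<close> is at stake, and 0.9 lies well beyond that angle.\<close>

lemma clearance_strict_mono:
  fixes a b :: real
  assumes "0.9 \<le> a" "a < b" "b < pi / 2"
  shows "3 * a - sin a - 2 * sin (2 * a) < 3 * b - sin b - 2 * sin (2 * b)"
proof (rule DERIV_pos_imp_increasing[OF \<open>a < b\<close>])
  fix x assume x: "a \<le> x" "x \<le> b"
  have c0: "0 < cos x" using x assms by (intro cos_gt_zero_pi) auto
  have "cos x \<le> cos (0.9 :: real)" using x assms pi_less_4 by (intro cos_monotone_0_pi_le) auto
  also have "\<dots> \<le> 1 - (0.9\<^sup>2 / 2) + 0.9 ^ 4 / 24"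
    using Maclaurin_cos_expansion2[of "0.9" 4]
    by (auto simp: cos_coeff_def lessThan_nat_numeral fact_numeral power2_eq_square)
  finally have c1: "cos x < 7 / 8" by (simp add: power_divide)
  have "3 - cos x - 4 * cos (2 * x) = (1 + cos x) * (7 - 8 * cos x)"
    using cos_double_cos[of x] by (simp add: algebra_simps power2_eq_square)
  also have "\<dots> > 0" using c0 c1 by (intro mult_pos_pos) auto
  finally have "0 < 3 - cos x - 4 * cos (2 * x)" .
  moreover have "((\<lambda>x. 3 * x - sin x - 2 * sin (2 * x)) has_real_derivative 3 - cos x - 4 * cos (2 * x)) (at x)"
    by (auto intro!: derivative_eq_intros)
  ultimately show "\<exists>D. ((\<lambda>x. 3 * x - sin x - 2 * sin (2 * x)) has_real_derivative D) (at x) \<and> 0 < D"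
    by blast
qed

lemma corner_above_bottom:
  assumes "1063 / 1169 \<le> \<psi>" "\<psi> < pi / 2"
  shows "0 < 3 * \<psi> - sin \<psi> - 2 * sin (2 * \<psi>)"
proof (cases "1063 / 1169 = \<psi>")
  case True
  show ?thesis unfolding True[symmetric] by (rule critical_angle_bound)
next
  case False
  then have "3 * (1063 / 1169) - sin (1063 / 1169) - 2 * sin (2 * (1063 / 1169)) < 3 * \<psi> - sin \<psi> - 2 * sin (2 * \<psi>)"
    using assms by (intro clearance_strict_mono) auto
  with critical_angle_bound show ?thesis by (rule less_trans)
qed

text \<open>Up to the factor \<open>r\<^sup>2 / 2\<close> this is the height on the left side of the
  first lap, at angle \<open>\<phi>\<close> from its midpoint. At \<open>\<phi> = \<psi>\<close> it
  is the quantity of \<open>corner_above_bottom\<close>.\<close>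

lemma left_arc_above_bottom:
  fixes \<phi> \<psi> :: real
  assumes \<psi>: "1063 / 1169 \<le> \<psi>" "\<psi> < pi / 2" and \<phi>: "\<bar>\<phi>\<bar> \<le> \<psi>"
  shows "0 \<le> 2 * \<psi> - sin (2 * \<psi>) + \<phi> - (1 + 2 * cos \<psi>) * sin \<phi>"
proof -
  have c0: "0 < cos \<psi>" using \<psi> by (intro cos_gt_zero_pi) auto
  have s0: "0 < sin \<psi>" using \<psi> by (intro sin_gt_zero2) auto
  consider "\<phi> \<le> 0" | "0 \<le> \<phi>" "pi / 3 \<le> \<psi>" | "0 \<le> \<phi>" "\<psi> < pi / 3" by linarith
  then show ?thesis
  proof cases
    case 1
    \<comment> \<open>Before the midpoint it suffices that the sine grows at most as fast as its
      argument.\<close>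
    have "sin \<psi> - sin (- \<phi>) = 2 * (sin ((\<psi> - - \<phi>) / 2) * cos ((\<psi> + - \<phi>) / 2))"
      by (simp only: sin_diff_sin)
    also have "\<dots> \<le> 2 * ((\<psi> - - \<phi>) / 2 * 1)"
      using \<phi> \<psi> 1 by (intro mult_left_mono mult_mono sin_x_le_x cos_le_one cos_ge_zero) auto
    finally have "sin \<psi> + sin \<phi> \<le> \<psi> + \<phi>" by simp
    moreover have "sin \<psi> \<le> \<psi>" using \<psi> by (intro sin_x_le_x) auto
    moreover have "sin \<psi> * cos \<psi> \<le> sin \<psi>" using s0 by (simp add: mult_left_le)
    moreover have "cos \<psi> * sin \<phi> \<le> 0"
      using c0 1 \<phi> \<psi> sin_ge_zero[of "- \<phi>"] by (intro mult_nonneg_nonpos) auto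
    ultimately show ?thesis using sin_double[of \<psi>] by (simp add: algebra_simps)
  next
    case 2
    \<comment> \<open>Here \<open>2 * \<psi> > 2\<close> absorbs both
      \<open>sin (2 * \<psi>) \<le> 1\<close> and
      \<open>2 * cos \<psi> * sin \<phi> \<le> 1\<close>.\<close>
    have "cos \<psi> \<le> cos (pi / 3)" using 2 \<psi> by (intro cos_monotone_0_pi_le) auto
    then have "cos \<psi> \<le> 1 / 2" by (simp add: cos_60)
    moreover have s: "0 \<le> sin \<phi>" using 2 \<phi> \<psi> by (intro sin_ge_zero) auto
    ultimately have "cos \<psi> * sin \<phi> \<le> 1 / 2 * sin \<phi>" by (intro mult_right_mono)
    moreover have "sin \<phi> \<le> \<phi>" "sin \<phi> \<le> 1" using 2 by (auto intro: sin_x_le_x)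
    moreover have "sin (2 * \<psi>) \<le> 1" by simp
    moreover have "(1 + 2 * cos \<psi>) * sin \<phi> = sin \<phi> + 2 * (cos \<psi> * sin \<phi>)"
      by (simp add: algebra_simps)
    ultimately show ?thesis using 2 pi_gt3 by linarith
  next
    case 3
    have "cos (pi / 3) \<le> cos \<psi>" using 3 \<psi> by (intro cos_monotone_0_pi_le) auto
    then have c: "1 / 2 \<le> cos \<psi>" by (simp add: cos_60)
    \<comment> \<open>With \<open>cos \<psi> \<ge> 1 / 2\<close> the factor
      \<open>(1 + 2 * cos \<psi>) * cos x\<close> is at least 1 on the whole side, so the height is
      smallest at the vertex.\<close>
    have "\<psi> - (1 + 2 * cos \<psi>) * sin \<psi> \<le> \<phi> - (1 + 2 * cos \<psi>) * sin \<phi>"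
    proof (rule DERIV_nonpos_imp_nonincreasing[of \<phi> \<psi>])
      fix x assume x: "\<phi> \<le> x" "x \<le> \<psi>"
      have "cos \<psi> \<le> cos x" using x 3 \<psi> by (intro cos_monotone_0_pi_le) auto
      then have "2 * (1 / 2) \<le> (1 + 2 * cos \<psi>) * cos x"
        using c by (intro mult_mono) auto
      then show "\<exists>D. ((\<lambda>x. x - (1 + 2 * cos \<psi>) * sin x) has_real_derivative D) (at x) \<and> D \<le> 0"
        by (intro exI[of _ "1 - (1 + 2 * cos \<psi>) * cos x"]) (auto intro!: derivative_eq_intros)
    qed (use \<phi> in auto)
    moreover have "0 < 3 * \<psi> - sin \<psi> - 2 * sin (2 * \<psi>)"
      using \<psi> by (rule corner_above_bottom)
    ultimately show ?thesis using sin_double[of \<psi>] by (simp add: algebra_simps)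
  qed
qed

section \<open>The lifted bigon\<close>

lemma int_multiples_finite:
  fixes w :: real
  assumes "0 < w"
  shows "finite ({t. \<exists>k::int. t = of_int k * w} \<inter> {a..b})"
proof (rule finite_subset)
  show "{t. \<exists>k::int. t = of_int k * w} \<inter> {a..b} \<subseteq> (\<lambda>k. of_int k * w) ` {\<lfloor>a / w\<rfloor>..\<lceil>b / w\<rceil>}"
  proof clarsimp
    fix k :: int assume "a \<le> of_int k * w" "of_int k * w \<le> b"
    then have "a / w \<le> of_int k" "of_int k \<le> b / w" using assms by (simp_all add: field_simps)
    then have "k \<in> {\<lfloor>a / w\<rfloor>..\<lceil>b / w\<rceil>}" by (simp add: floor_le_iff le_ceiling_iff)
    then show "of_int k * w \<in> (\<lambda>k. of_int k * w) ` {\<lfloor>a / w\<rfloor>..\<lceil>b / w\<rceil>}" by blast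
  qed
qed simp

definition parity_sign :: "int \<Rightarrow> real" where
  "parity_sign n = (if even n then 1 else - 1)"

lemma parity_sign_sq: "parity_sign n * parity_sign n = 1"
  and parity_sign_Suc: "parity_sign (n + 1) = - parity_sign n"
  and parity_sign_add_even: "parity_sign (n + 2 * j) = parity_sign n"
  and parity_sign_mem: "parity_sign n \<in> {1, -1}"
  by (auto simp: parity_sign_def)

text \<open>With \<open>r\<close> instead of \<open>d\<close> as parameter, \<open>d\<close> and
  \<open>R\<close> are free of division; \<open>arc_rad_eq\<close> leads back.\<close>

locale bigon_table =
  fixes r \<psi> :: real
  assumes r_pos: "0 < r" and psi_pos: "0 < \<psi>" and psi_less: "\<psi> < pi / 2"
begin

definition d :: real where "d = r + r * cos \<psi>"
definition R :: real where "R = r * sin \<psi>"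
text \<open>Half the length of a side: side \<open>n\<close> occupies the times from
  \<open>(2 n - 1) w\<close> to \<open>(2 n + 1) w\<close>.\<close>

definition w :: real where "w = r * \<psi>"
text \<open>The area of the bigon and, by Green's theorem, the height gained in one lap.\<close>

definition h :: real where "h = r\<^sup>2 * (2 * \<psi> - sin (2 * \<psi>))"

lemma cos_pos: "0 < cos \<psi>" using psi_pos psi_less by (intro cos_gt_zero_pi) auto
lemma sin_pos: "0 < sin \<psi>" using psi_pos psi_less by (intro sin_gt_zero2) auto
lemma d_pos: "0 < d" using cos_pos r_pos by (simp add: d_def add_pos_pos)
lemma w_pos: "0 < w" using r_pos psi_pos by (simp add: w_def)
lemma w_div_r: "w / r = \<psi>" using r_pos by (simp add: w_def)
lemma R_pos: "0 < R" using r_pos sin_pos by (simp add: R_def)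

lemma arc_rad_eq: "arc_rad d \<psi> = r"
proof -
  have "d = r * (1 + cos \<psi>)" by (simp add: d_def distrib_left)
  then show ?thesis using cos_pos by (simp add: arc_rad_def)
qed

lemma lap_eq: "lap d \<psi> = 4 * w" by (simp add: lap_def w_def arc_rad_eq)
lemma disc_rad_eq: "disc_rad d \<psi> = R" by (simp add: disc_rad_def R_def arc_rad_eq)

lemma h_pos: "0 < h"
proof -
  have "cos \<psi> < 1" using cos_monotone_0_pi[of 0 \<psi>] psi_pos psi_less by simp
  then have "sin \<psi> * cos \<psi> < sin \<psi>" using sin_pos by simp
  also have "\<dots> \<le> \<psi>" using psi_pos by (intro sin_x_le_x) simp
  finally show ?thesis using r_pos by (simp add: h_def sin_double mult.assoc)
qed

lemma R_less_d: "R < d"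
proof -
  have "sin \<psi> \<le> 1" by simp
  then have "sin \<psi> < 1 + cos \<psi>" using cos_pos by linarith
  then have "r * sin \<psi> < r * (1 + cos \<psi>)" using r_pos by (intro mult_strict_left_mono)
  then show ?thesis by (simp add: R_def d_def distrib_left)
qed

lemma sq_sums: "d\<^sup>2 - R\<^sup>2 = 2 * d * r * cos \<psi>" "d\<^sup>2 + R\<^sup>2 = 2 * d * r"
  using sin_cos_squared_add2[of \<psi>] unfolding d_def R_def by algebra+

lemma r_from_radii: "r = (R\<^sup>2 + d\<^sup>2) / (2 * d)"
  using sq_sums d_pos by (simp add: add.commute)

lemma psi_from_radii: "\<psi> = arccos ((d\<^sup>2 - R\<^sup>2) / (d\<^sup>2 + R\<^sup>2))"
  using d_pos r_pos psi_pos psi_less by (simp add: sq_sums arccos_cos)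

text \<open>The time \<open>s\<close> is counted from the midpoint of the side. The midpoints are
  \<open>h / 2\<close> apart in height, and the second summand of the height, odd in
  \<open>s\<close>, is the integral of \<open>(x dy - y dx) / 2\<close> from the midpoint.\<close>

definition piece :: "int \<Rightarrow> real \<Rightarrow> space" where
  "piece n s = ((d + parity_sign n * (r * cos (s / r) - r * cos \<psi>), parity_sign n * (r * sin (s / r))),
     of_int n * h / 2 + r / 2 * (s + (parity_sign n * d - r * cos \<psi>) * sin (s / r)))"

definition velocity :: "int \<Rightarrow> real \<Rightarrow> space" where
  "velocity n s = ((- parity_sign n * sin (s / r), parity_sign n * cos (s / r)),
     (r + (parity_sign n * d - r * cos \<psi>) * cos (s / r)) / 2)"

text \<open>This is \<open>(1 / r) \<alpha> + b dx + c' dy\<close> at \<open>piece n s\<close>, with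
  \<open>(b, c')\<close> the planar velocity, in the basis dx, dy, dz. The curvature is
  \<open>1 / r\<close> on both sides since both are traversed counterclockwise.\<close>

definition momentum :: "int \<Rightarrow> real \<Rightarrow> space" where
  "momentum n s = ((- parity_sign n * sin (s / r) / 2,
     (parity_sign n * (cos (s / r) + cos \<psi>) - (1 + cos \<psi>)) / 2), 1 / r)"

lemma piece_has_derivative: "(piece n has_vector_derivative velocity n s) (at s)"
  unfolding piece_def velocity_def using r_pos
  by (intro has_vector_derivative_Pair;
      auto simp: has_real_derivative_iff_has_vector_derivative[symmetric] intro!: derivative_eq_intros;
      simp add: field_simps)

lemma momentum_has_derivative:
  "(momentum n has_vector_derivative
     ((- parity_sign n * cos (s / r) / (2 * r), - parity_sign n * sin (s / r) / (2 * r)), 0)) (at s)"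
  unfolding momentum_def using r_pos
  by (intro has_vector_derivative_Pair;
      auto simp: has_real_derivative_iff_has_vector_derivative[symmetric] intro!: derivative_eq_intros;
      simp add: field_simps)

lemma velocity_horizontal:
  "snd (velocity n s) =
    (fst (fst (piece n s)) * snd (fst (velocity n s)) - snd (fst (piece n s)) * fst (fst (velocity n s))) / 2"
proof -
  define S K e where "S = sin (s / r)" and "K = cos (s / r)" and "e = parity_sign n"
  have "S\<^sup>2 + K\<^sup>2 = 1" "e * e = 1" by (simp_all add: S_def K_def e_def parity_sign_sq)
  then have "r + (e * d - r * cos \<psi>) * K =
      (d + e * (r * K - r * cos \<psi>)) * (e * K) - e * (r * S) * (- e * S)"
    by algebra
  then show ?thesis by (simp add: piece_def velocity_def S_def K_def e_def)
qed

text \<open>Both directions of travel at once: the dual norm is even in the momentum, so running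
  backwards with negated momentum again solves Hamilton's equations, with curvature
  \<open>\<sigma> / r\<close>. The hypothesis is local because the orbit agrees with one arc only
  near \<open>t\<close>.\<close>

lemma hamilton_arc:
  assumes \<sigma>: "\<sigma> \<in> {1, -1}"
    and ev: "\<forall>\<^sub>F u in nhds t. q u = piece n (\<sigma> * u + C) \<and> p u = \<sigma> *\<^sub>R momentum n (\<sigma> * u + C)"
  shows "p t \<in> unit_covectors (q t) \<and> hamilton_eq_at q p t"
proof -
  define s e where "s = \<sigma> * t + C" and "e = parity_sign n"
  define S K where "S = sin (s / r)" and "K = cos (s / r)"
  have SK: "S\<^sup>2 + K\<^sup>2 = 1" by (simp add: S_def K_def)
  have at_t: "q t = piece n s" "p t = \<sigma> *\<^sub>R momentum n s"
    using eventually_nhds_x_imp_x[OF ev] by (simp_all add: s_def)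
  have aff: "((\<lambda>u. \<sigma> * u + C) has_vector_derivative \<sigma>) (at t)"
    by (auto simp: has_real_derivative_iff_has_vector_derivative[symmetric] intro!: derivative_eq_intros)
  have e2: "e * e = 1" and s2: "\<sigma> * \<sigma> = 1" using \<sigma> parity_sign_sq by (auto simp: e_def)
  have evq: "\<forall>\<^sub>F u in nhds t. u \<in> UNIV \<longrightarrow> q u = (piece n \<circ> (\<lambda>u. \<sigma> * u + C)) u"
    and evp: "\<forall>\<^sub>F u in nhds t. u \<in> UNIV \<longrightarrow> p u = \<sigma> *\<^sub>R (momentum n \<circ> (\<lambda>u. \<sigma> * u + C)) u"
    using ev by (auto elim: eventually_mono)
  have "(piece n \<circ> (\<lambda>u. \<sigma> * u + C) has_vector_derivative \<sigma> *\<^sub>R velocity n s) (at t)"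
    unfolding s_def by (rule vector_diff_chain_at[OF aff piece_has_derivative])
  then have q: "(q has_vector_derivative \<sigma> *\<^sub>R velocity n s) (at t)"
    using has_vector_derivative_cong_ev[OF evq] at_t by (simp add: s_def o_def)
  have "((\<lambda>u. \<sigma> *\<^sub>R (momentum n \<circ> (\<lambda>u. \<sigma> * u + C)) u) has_vector_derivative
      \<sigma> *\<^sub>R (\<sigma> *\<^sub>R ((- e * K / (2 * r), - e * S / (2 * r)), 0))) (at t)"
    unfolding s_def e_def S_def K_def
    by (intro bounded_linear.has_vector_derivative[OF bounded_linear_scaleR_right]
        vector_diff_chain_at[OF aff momentum_has_derivative])
  then have p: "(p has_vector_derivative ((- e * K / (2 * r), - e * S / (2 * r)), 0)) (at t)"
    using has_vector_derivative_cong_ev[OF evp] at_t s2 by (simp add: s_def o_def mult.assoc[symmetric])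
  show ?thesis
  proof (rule hamilton_eqI)
    show "q t = ((fst (fst (piece n s)), snd (fst (piece n s))), snd (piece n s))" by (simp add: at_t)
    show "(q has_vector_derivative ((\<sigma> * (- e * S), \<sigma> * (e * K)),
        (fst (fst (piece n s)) * (\<sigma> * (e * K)) - snd (fst (piece n s)) * (\<sigma> * (- e * S))) / 2)) (at t)"
    proof -
      have "\<sigma> *\<^sub>R velocity n s = ((\<sigma> * (- e * S), \<sigma> * (e * K)), \<sigma> * snd (velocity n s))"
        by (simp add: velocity_def e_def S_def K_def)
      also have "\<sigma> * snd (velocity n s) =
          (fst (fst (piece n s)) * (\<sigma> * (e * K)) - snd (fst (piece n s)) * (\<sigma> * (- e * S))) / 2"
        unfolding velocity_horizontal
        by (simp add: velocity_def e_def S_def K_def algebra_simps)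
      finally show ?thesis using q by simp
    qed
    show "(p has_vector_derivative
        ((- (\<sigma> / r) * (\<sigma> * (e * K)) / 2, (\<sigma> / r) * (\<sigma> * (- e * S)) / 2), 0)) (at t)"
    proof -
      have "\<sigma> / r * (\<sigma> * x) / 2 = x / (2 * r)" for x using \<sigma> by auto
      from this[of "- e * K"] this[of "- e * S"] show ?thesis using p by simp
    qed
    show "p t = ((\<sigma> * (- e * S) + \<sigma> / r * snd (fst (piece n s)) / 2,
        \<sigma> * (e * K) - \<sigma> / r * fst (fst (piece n s)) / 2), \<sigma> / r)"
      using r_pos by (simp add: at_t momentum_def piece_def e_def[symmetric] S_def[symmetric] K_def[symmetric] d_def)
        (simp add: field_simps)
    show "(\<sigma> * (- e * S))\<^sup>2 + (\<sigma> * (e * K))\<^sup>2 = 1"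
      using SK e2 s2 by algebra
  qed
qed

text \<open>The heights match because half a right side followed by half a left side climbs exactly
  \<open>h / 2\<close>, the difference between consecutive midpoints.\<close>

lemma arc_corner: "piece n w = piece (n + 1) (- w)"
  by (simp add: piece_def parity_sign_Suc w_div_r)
    (use sin_double[of \<psi>] in \<open>simp add: h_def w_def d_def power2_eq_square field_simps\<close>)

text \<open>Rounds \<open>t / (2 w)\<close> to the nearest integer; a vertex is assigned to the side
  that starts there.\<close>

definition side :: "real \<Rightarrow> int" where "side t = \<lfloor>(t + w) / (2 * w)\<rfloor>"
definition lift :: "real \<Rightarrow> space" where "lift t = piece (side t) (t - 2 * of_int (side t) * w)"
definition lifted_momentum :: "real \<Rightarrow> space" where
  "lifted_momentum t = momentum (side t) (t - 2 * of_int (side t) * w)"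

lemma side_bounds: "- w \<le> t - 2 * of_int (side t) * w" "t - 2 * of_int (side t) * w < w"
  using floor_divide_lower[of "2 * w" "t + w"] floor_divide_upper[of "2 * w" "t + w"] w_pos
  by (simp_all add: side_def algebra_simps)

lemma side_eqI: "- w \<le> t - 2 * of_int n * w \<Longrightarrow> t - 2 * of_int n * w < w \<Longrightarrow> side t = n"
  using w_pos by (simp add: side_def floor_eq_iff field_simps)

text \<open>The position agrees with the arc on the closed side, since \<open>arc_corner\<close>
  covers the end that \<open>side\<close> assigns to the next one. The momentum jumps there, so
  \<open>lifted_momentum_eq\<close> excludes that end.\<close>

lemma lift_eq:
  assumes "\<bar>t - 2 * of_int n * w\<bar> \<le> w"
  shows "lift t = piece n (t - 2 * of_int n * w)"
proof (cases "t - 2 * of_int n * w < w")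
  case True
  then show ?thesis using assms side_eqI[of t n] by (simp add: lift_def)
next
  case False
  then have t: "t - 2 * of_int n * w = w" using assms by simp
  then have "side t = n + 1" using w_pos by (intro side_eqI) (auto simp: algebra_simps)
  moreover have "t - 2 * of_int (n + 1) * w = - w" using t by (simp add: algebra_simps)
  ultimately show ?thesis unfolding t by (simp add: lift_def arc_corner)
qed

lemma lifted_momentum_eq:
  "- w \<le> t - 2 * of_int n * w \<Longrightarrow> t - 2 * of_int n * w < w \<Longrightarrow>
    lifted_momentum t = momentum n (t - 2 * of_int n * w)"
  using side_eqI[of t n] by (simp add: lifted_momentum_def)

lemma lift_has_derivative:
  assumes "\<bar>t - 2 * of_int n * w\<bar> < w"
  shows "(lift has_vector_derivative velocity n (t - 2 * of_int n * w)) (at t)"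
proof -
  have "((\<lambda>u. u - 2 * of_int n * w) has_vector_derivative 1) (at t)"
    by (auto simp: has_real_derivative_iff_has_vector_derivative[symmetric] intro!: derivative_eq_intros)
  from vector_diff_chain_at[OF this piece_has_derivative]
  have "((\<lambda>u. piece n (u - 2 * of_int n * w)) has_vector_derivative velocity n (t - 2 * of_int n * w)) (at t)"
    by (simp add: o_def)
  moreover have "t \<in> {2 * of_int n * w - w <..< 2 * of_int n * w + w}" using assms by (auto simp: abs_less_iff)
  ultimately show ?thesis
    by (rule has_vector_derivative_transform_within_open[OF _ open_greaterThanLessThan])
      (rule lift_eq[symmetric], auto simp: abs_le_iff)
qed

lemma isCont_piece: "isCont (piece n) s"
  using piece_has_derivative by (rule has_vector_derivative_continuous)

lemma isCont_momentum: "isCont (momentum n) s"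
  using momentum_has_derivative by (rule has_vector_derivative_continuous)

lemma isCont_lift: "isCont lift t"
proof -
  define n where "n = side t"
  have 1: "- w \<le> t - 2 * of_int n * w" "t - 2 * of_int n * w < w"
    using side_bounds by (simp_all add: n_def)
  show ?thesis
  proof (cases "t - 2 * of_int n * w = - w")
    case False
    then have "\<bar>t - 2 * of_int n * w\<bar> < w" using 1 by auto
    then show ?thesis using lift_has_derivative has_vector_derivative_continuous by blast
  next
    case True
    have c: "isCont (\<lambda>u. piece m (u - 2 * of_int m * w)) t" for m
      by (rule isCont_o2[OF _ isCont_piece]) (intro continuous_intros)
    have ev: "\<forall>\<^sub>F u in at_right t. u \<in> {t<..<t + w}" "\<forall>\<^sub>F u in at_left t. u \<in> {t - w<..<t}"
      by (rule eventually_at_right_real eventually_at_left_real, use w_pos in simp)+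
    have r: "\<forall>\<^sub>F u in at_right t. piece n (u - 2 * of_int n * w) = lift u"
      using ev(1) by eventually_elim (rule lift_eq[symmetric], use True in auto)
    have l: "\<forall>\<^sub>F u in at_left t. piece (n - 1) (u - 2 * of_int (n - 1) * w) = lift u"
      using ev(2)
      by eventually_elim (rule lift_eq[symmetric], use True in \<open>auto simp: algebra_simps\<close>)
    have "lift t = piece n (t - 2 * of_int n * w)" using True w_pos by (intro lift_eq) auto
    then have "(lift \<longlongrightarrow> lift t) (at_right t)"
      using Lim_transform_eventually[OF _ r] c[of n, THEN continuous_at_imp_continuous_at_within]
      unfolding continuous_within by metis
    moreover have "lift t = piece (n - 1) (t - 2 * of_int (n - 1) * w)"
      using True w_pos by (intro lift_eq) (auto simp: algebra_simps)
    then have "(lift \<longlongrightarrow> lift t) (at_left t)"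
      using Lim_transform_eventually[OF _ l] c[of "n - 1", THEN continuous_at_imp_continuous_at_within]
      unfolding continuous_within by metis
    ultimately show ?thesis by (simp add: continuous_at_split continuous_within[of t _ lift])
  qed
qed

section \<open>Agreement with the given curve and its horizontal lift\<close>

lemma fst_lift_periodic: "fst (lift (t + of_int j * (4 * w))) = fst (lift t)"
proof -
  have eq: "t + of_int j * (4 * w) - 2 * of_int (side t + 2 * j) * w = t - 2 * of_int (side t) * w"
    by (simp add: algebra_simps)
  then have "side (t + of_int j * (4 * w)) = side t + 2 * j"
    using side_bounds[of t] by (intro side_eqI) simp_all
  then show ?thesis by (simp only: lift_def eq) (simp add: piece_def parity_sign_add_even)
qed

lemma bigon_eq:
  assumes "0 \<le> t" "t \<le> 4 * w"
  shows "bigon d \<psi> t = fst (lift t)"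
proof -
  note b = bigon_def[of d \<psi>, unfolded Let_def arc_rad_eq]
  \<comment> \<open>A lap starts at the midpoint of the right side, hence consists of the second
    half of side 0, side 1 and the first half of side 2.\<close>
  consider "t \<le> w" | "w < t" "t \<le> 3 * w" | "3 * w < t" by linarith
  then show ?thesis
  proof cases
    case 1
    then have "lift t = piece 0 t" using assms lift_eq[of t 0] by simp
    then show ?thesis using 1 by (simp add: b w_def[symmetric] piece_def parity_sign_def) (simp add: d_def)
  next
    case 2
    then have "lift t = piece 1 (t - 2 * w)" using lift_eq[of t 1] by simp
    moreover have shift: "pi - 2 * \<psi> + t / r = (t - 2 * w) / r + pi" using r_pos by (simp add: w_def field_simps)
    have "cos (pi - 2 * \<psi> + t / r) = - cos ((t - 2 * w) / r)" "sin (pi - 2 * \<psi> + t / r) = - sin ((t - 2 * w) / r)"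
      unfolding shift by simp_all
    ultimately show ?thesis using 2 by (simp add: b w_def[symmetric] mult.assoc piece_def parity_sign_def) (simp add: d_def)
  next
    case 3
    then have "lift t = piece 2 (t - 4 * w)" using lift_eq[of t 2] assms by simp
    moreover have "t / r - 4 * \<psi> = (t - 4 * w) / r" using r_pos by (simp add: w_def field_simps)
    ultimately show ?thesis using 3 w_pos by (simp add: b w_def[symmetric] mult.assoc piece_def parity_sign_def) (simp add: d_def)
  qed
qed

lemma nu_eq: "nu d \<psi> t = fst (lift t)"
proof -
  have w4: "0 < 4 * w" using w_pos by simp
  define j where "j = \<lfloor>t / (4 * w)\<rfloor>"
  have "t rmod (4 * w) = t - of_int j * (4 * w)" using w4 by (simp add: rmod_def j_def)
  moreover have "0 \<le> t rmod (4 * w)" "t rmod (4 * w) \<le> 4 * w" using w4 rmod_nonneg rmod_le by auto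
  ultimately show ?thesis
    using bigon_eq fst_lift_periodic[of "t - of_int j * (4 * w)" j] by (simp add: nu_def lap_eq)
qed

lemma lift_0: "lift 0 = ((2 * r, 0), 0)"
  using lift_eq[of 0 0] w_pos by (simp add: piece_def parity_sign_def) (simp add: d_def)

lemma lift_lap: "lift (real m * (4 * w)) = ((2 * r, 0), real m * h)"
  using lift_eq[of "real m * (4 * w)" "2 * int m"] w_pos
  by (simp add: piece_def parity_sign_def algebra_simps) (simp add: d_def)

text \<open>The height of \<open>lift\<close> is a continuous antiderivative of the integrand except
  at the vertices, where \<open>vector_derivative\<close> carries no information. These are among
  the finitely many multiples of \<open>w\<close> in the interval, which the fundamental theorem
  tolerates.\<close>

lemma hlift_eq:
  assumes "0 \<le> t"
  shows "hlift (nu d \<psi>) 0 t = lift t"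
proof -
  define S where "S = {u. \<exists>k::int. u = of_int k * w} \<inter> {0..t}"
  define g where "g s = (case (nu d \<psi> s, vector_derivative (nu d \<psi>) (at s)) of
     ((x, y), (x', y')) \<Rightarrow> (x * y' - y * x') / 2)" for s
  have "(g has_integral snd (lift t) - snd (lift 0)) {0..t}"
  proof (rule fundamental_theorem_of_calculus_interior_strong)
    show "finite S" unfolding S_def by (rule int_multiples_finite[OF w_pos])
    show "continuous_on {0..t} (\<lambda>t. snd (lift t))"
      by (intro continuous_on_snd continuous_at_imp_continuous_on ballI isCont_lift)
    fix s assume s: "s \<in> {0<..<t} - S"
    define n where "n = side s"
    have "s - 2 * of_int n * w \<noteq> - w"
    proof
      assume "s - 2 * of_int n * w = - w"
      then have "s = of_int (2 * n - 1) * w" by (simp add: algebra_simps)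
      then show False using s unfolding S_def by fastforce
    qed
    then have n: "\<bar>s - 2 * of_int n * w\<bar> < w" using side_bounds[of s] by (auto simp: n_def)
    note D = lift_has_derivative[OF n]
    have "(nu d \<psi> has_vector_derivative fst (velocity n (s - 2 * of_int n * w))) (at s)"
      using bounded_linear.has_vector_derivative[OF bounded_linear_fst D] unfolding nu_eq[abs_def] .
    then have "vector_derivative (nu d \<psi>) (at s) = fst (velocity n (s - 2 * of_int n * w))"
      by (rule vector_derivative_at)
    then have "g s = snd (velocity n (s - 2 * of_int n * w))"
      using lift_eq[of s n] n by (simp add: g_def nu_eq case_prod_beta velocity_horizontal)
    then show "((\<lambda>t. snd (lift t)) has_vector_derivative g s) (at s)"
      using bounded_linear.has_vector_derivative[OF bounded_linear_snd D] by simp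
  qed (fact assms)
  then have "integral {0..t} g = snd (lift t)" by (simp add: lift_0 integral_unique)
  then show ?thesis by (simp add: hlift_def nu_eq g_def[abs_def] prod_eq_iff)
qed

text \<open>At angle \<open>\<phi>\<close> the squared distance from \<open>(d, 0)\<close> exceeds
  \<open>R\<^sup>2\<close> by \<open>2 r\<^sup>2 cos \<psi> (cos \<psi> - cos \<phi>)\<close>, which
  is nonpositive on the side and zero at the vertices.\<close>

lemma arc_in_disc:
  assumes "\<bar>s\<bar> \<le> w"
  shows "fst (piece n s) \<in> cball (d, 0) R"
proof -
  define \<phi> where "\<phi> = s / r"
  have "\<bar>\<phi>\<bar> \<le> \<psi>" using assms r_pos by (simp add: \<phi>_def w_def field_simps)
  then have "cos \<psi> \<le> cos \<bar>\<phi>\<bar>" using psi_less by (intro cos_monotone_0_pi_le) auto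
  then have "cos \<psi> * (cos \<psi> - cos \<phi>) \<le> 0" using cos_pos by (simp add: mult_le_0_iff)
  then have "r\<^sup>2 * (2 * (cos \<psi> * (cos \<psi> - cos \<phi>))) \<le> 0" by (simp add: mult_le_0_iff)
  moreover have "(r * cos \<phi> - r * cos \<psi>)\<^sup>2 + (r * sin \<phi>)\<^sup>2 - R\<^sup>2 = r\<^sup>2 * (2 * (cos \<psi> * (cos \<psi> - cos \<phi>)))"
    using sin_cos_squared_add2[of \<psi>] sin_cos_squared_add2[of \<phi>] unfolding R_def by algebra
  ultimately have "(r * cos \<phi> - r * cos \<psi>)\<^sup>2 + (r * sin \<phi>)\<^sup>2 \<le> R\<^sup>2" by linarith
  then show ?thesis
    using parity_sign_mem[of n]
    by (auto simp: piece_def mem_cball_plane[OF R_pos] \<phi>_def[symmetric] power2_commute simp del: mem_cball)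
qed

lemma nu_in_disc: "range (nu d \<psi>) \<subseteq> cball (d, 0) R"
proof (rule image_subsetI)
  fix t
  have "\<bar>t - 2 * of_int (side t) * w\<bar> \<le> w" using side_bounds[of t] by auto
  then show "nu d \<psi> t \<in> cball (d, 0) R" unfolding nu_eq lift_def by (rule arc_in_disc)
qed

lemma bigon_image:
  "bigon d \<psi> ` {0..4 * w} = frontier (cball (r, 0) r \<inter> cball (r + 2 * r * cos \<psi>, 0) r)"
  unfolding frontier_lens[OF r_pos psi_pos psi_less]
proof (intro equalityI subsetI)
  let ?A = "(\<lambda>\<phi>. (r + r * cos \<phi>, r * sin \<phi>)) ` {-\<psi>..\<psi>}"
  let ?B = "(\<lambda>\<phi>. (r + 2 * r * cos \<psi> - r * cos \<phi>, - (r * sin \<phi>))) ` {-\<psi>..\<psi>}"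
  have A: "fst (piece n s) = (r + r * cos (s / r), r * sin (s / r))" if "even n" for n s
    using that by (simp add: piece_def parity_sign_def d_def)
  have B: "fst (piece 1 s) = (r + 2 * r * cos \<psi> - r * cos (s / r), - (r * sin (s / r)))" for s
    by (simp add: piece_def parity_sign_def d_def)
  have ang: "s / r \<in> {-\<psi>..\<psi>}" if "\<bar>s\<bar> \<le> w" for s
    using that r_pos by (auto simp: w_def field_simps abs_le_iff)
  {
    fix q assume "q \<in> bigon d \<psi> ` {0..4 * w}"
    then obtain t where t: "0 \<le> t" "t \<le> 4 * w" "q = fst (lift t)" using bigon_eq by auto
    consider "t \<le> w" | "w \<le> t" "t \<le> 3 * w" | "3 * w \<le> t" by linarith
    then show "q \<in> ?A \<union> ?B"
    proof cases
      case 1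
      then have "lift t = piece 0 t" using t lift_eq[of t 0] by simp
      then have "q = (r + r * cos (t / r), r * sin (t / r))" by (simp add: t A)
      moreover have "t / r \<in> {-\<psi>..\<psi>}" using 1 t by (intro ang) simp
      ultimately show ?thesis by blast
    next
      case 2
      then have "lift t = piece 1 (t - 2 * w)" using lift_eq[of t 1] by simp
      then have "q = (r + 2 * r * cos \<psi> - r * cos ((t - 2 * w) / r), - (r * sin ((t - 2 * w) / r)))"
        by (simp only: t B)
      moreover have "(t - 2 * w) / r \<in> {-\<psi>..\<psi>}" using 2 by (intro ang) simp
      ultimately show ?thesis by blast
    next
      case 3
      then have "lift t = piece 2 (t - 4 * w)" using t lift_eq[of t 2] by simp
      then have "q = (r + r * cos ((t - 4 * w) / r), r * sin ((t - 4 * w) / r))" by (simp add: t A)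
      moreover have "(t - 4 * w) / r \<in> {-\<psi>..\<psi>}" using 3 t by (intro ang) simp
      ultimately show ?thesis by blast
    qed
  }
  have img: "fst (lift t) \<in> bigon d \<psi> ` {0..4 * w}" if "0 \<le> t" "t \<le> 4 * w" for t
    using that bigon_eq[of t] by (intro image_eqI[of _ _ t]) auto
  have le: "\<bar>r * \<phi>\<bar> \<le> w" if "\<phi> \<in> {-\<psi>..\<psi>}" for \<phi>
  proof -
    have "\<bar>\<phi>\<bar> \<le> \<psi>" using that by (simp add: abs_le_iff)
    then show ?thesis using r_pos by (simp add: w_def abs_mult)
  qed
  have div: "r * \<phi> / r = \<phi>" for \<phi> using r_pos by simp
  {
    fix q assume "q \<in> ?A \<union> ?B"
    then show "q \<in> bigon d \<psi> ` {0..4 * w}"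
    proof (elim UnE imageE)
      fix \<phi> assume \<phi>: "q = (r + r * cos \<phi>, r * sin \<phi>)" "\<phi> \<in> {-\<psi>..\<psi>}"
      note l = le[OF \<phi>(2)]
      show ?thesis
      \<comment> \<open>The right side is split by the starting point: its upper half opens the lap,
        its lower half closes it.\<close>
      proof (cases "0 \<le> r * \<phi>")
        case True
        have "lift (r * \<phi>) = piece 0 (r * \<phi>)" using lift_eq[of "r * \<phi>" 0] l by simp
        then have "q = fst (lift (r * \<phi>))" by (simp add: \<phi> A div)
        then show ?thesis using img[of "r * \<phi>"] True l w_pos by simp
      next
        case False
        have "lift (r * \<phi> + 4 * w) = piece 2 (r * \<phi>)" using lift_eq[of "r * \<phi> + 4 * w" 2] l by simp
        then have "q = fst (lift (r * \<phi> + 4 * w))" by (simp add: \<phi> A div)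
        then show ?thesis using img[of "r * \<phi> + 4 * w"] False l w_pos by simp
      qed
    next
      fix \<phi> assume \<phi>: "q = (r + 2 * r * cos \<psi> - r * cos \<phi>, - (r * sin \<phi>))" "\<phi> \<in> {-\<psi>..\<psi>}"
      note l = le[OF \<phi>(2)]
      have "lift (r * \<phi> + 2 * w) = piece 1 (r * \<phi>)" using lift_eq[of "r * \<phi> + 2 * w" 1] l by simp
      then have "q = fst (lift (r * \<phi> + 2 * w))" by (simp only: \<phi> B div)
      then show ?thesis using img[of "r * \<phi> + 2 * w"] l w_pos by simp
    qed
  }
qed

text \<open>The bigon is the frontier of a bounded convex set, whose inside is the interior; this
  takes the place of a Jordan curve argument.\<close>

lemma bounded_area_eq: "bounded_area d \<psi> c = real c * h"
proof -
  let ?K = "cball (r, 0 :: real) r \<inter> cball (r + 2 * r * cos \<psi>, 0) r"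
  have "inside (bigon d \<psi> ` {0..lap d \<psi>}) = interior ?K"
    unfolding lap_eq bigon_image by (intro inside_frontier_eq_interior bounded_Int convex_Int) auto
  also have "\<dots> = ball (r, 0) r \<inter> ball (r + 2 * r * cos \<psi>, 0) r" by simp
  finally have "measure lebesgue (inside (bigon d \<psi> ` {0..lap d \<psi>})) = h"
    using measure_lens[OF r_pos psi_pos psi_less]
    by (simp add: measure_completion h_def borel_open open_Int)
  then show ?thesis by (simp add: bounded_area_def)
qed

end

section \<open>The billiard trajectory\<close>

text \<open>The two inequalities carry all that depends on the size of \<open>\<psi>\<close>. The
  weak one keeps the left sides in the table; the strict one keeps the vertices off the rims, where
  wall and lids meet and there is no tangent plane.\<close>

locale clear_bigon_table = bigon_table +
  fixes c :: nat
  assumes c_pos: "0 < c"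
    and clear_side: "\<bar>\<phi>\<bar> \<le> \<psi> \<Longrightarrow> 0 \<le> 2 * \<psi> - sin (2 * \<psi>) + \<phi> - (1 + 2 * cos \<psi>) * sin \<phi>"
    and clear_corner: "0 < 3 * \<psi> - sin \<psi> - 2 * sin (2 * \<psi>)"
begin

definition H :: real where "H = real c * h"
definition L :: real where "L = real c * (4 * w)"

lemma H_pos: "0 < H" using c_pos h_pos by (simp add: H_def)
lemma L_pos: "0 < L" using c_pos w_pos by (simp add: L_def)

section \<open>Heights along the lift\<close>

definition rise :: "int \<Rightarrow> real \<Rightarrow> real" where
  "rise n s = r / 2 * (s + (parity_sign n * d - r * cos \<psi>) * sin (s / r))"

lemma snd_piece: "snd (piece n s) = of_int n * h / 2 + rise n s"
  by (simp add: piece_def rise_def)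

lemma rise_even: "even n \<Longrightarrow> rise n s = r\<^sup>2 / 2 * (s / r + sin (s / r))"
  using r_pos by (simp add: rise_def parity_sign_def d_def power2_eq_square field_simps)

lemma rise_odd: "odd n \<Longrightarrow> rise n s = r\<^sup>2 / 2 * (s / r - (1 + 2 * cos \<psi>) * sin (s / r))"
  using r_pos by (simp add: rise_def parity_sign_def d_def power2_eq_square field_simps)

lemma angle_bound: "\<bar>s\<bar> \<le> w \<Longrightarrow> \<bar>s / r\<bar> \<le> \<psi>"
  using r_pos by (simp add: w_def field_simps)

text \<open>The rise is odd in \<open>s\<close>, so \<open>clear_side\<close> at
  \<open>\<phi>\<close> and at \<open>- \<phi>\<close> gives both bounds.\<close>

lemma rise_odd_bounds:
  assumes "odd n" "\<bar>s\<bar> \<le> w"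
  shows "- (h / 2) \<le> rise n s" "rise n s \<le> h / 2"
proof -
  define \<phi> where "\<phi> = s / r"
  have "\<bar>\<phi>\<bar> \<le> \<psi>" "\<bar>- \<phi>\<bar> \<le> \<psi>" using angle_bound[OF assms(2)] by (simp_all add: \<phi>_def)
  from this[THEN clear_side]
  have "r\<^sup>2 / 2 * (- (2 * \<psi> - sin (2 * \<psi>))) \<le> r\<^sup>2 / 2 * (\<phi> - (1 + 2 * cos \<psi>) * sin \<phi>)"
    "r\<^sup>2 / 2 * (\<phi> - (1 + 2 * cos \<psi>) * sin \<phi>) \<le> r\<^sup>2 / 2 * (2 * \<psi> - sin (2 * \<psi>))"
    by (intro mult_left_mono; simp)+
  then show "- (h / 2) \<le> rise n s" "rise n s \<le> h / 2"
    unfolding rise_odd[OF assms(1)] \<phi>_def[symmetric] h_def mult_minus_right by simp_all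
qed

text \<open>Reflection in the x-axis together with reversal of time turns height \<open>z\<close>
  within a lap into \<open>h - z\<close> and exchanges the two vertices. This is thus
  \<open>clear_corner\<close> seen from the top.\<close>

lemma corner_rise_less_h: "r\<^sup>2 / 2 * (\<psi> + sin \<psi>) < h"
proof -
  have "r\<^sup>2 / 2 * (\<psi> + sin \<psi>) < r\<^sup>2 / 2 * (2 * (2 * \<psi> - sin (2 * \<psi>)))"
    using clear_corner r_pos by (intro mult_strict_left_mono) simp_all
  also have "\<dots> = h" by (simp add: h_def)
  finally show ?thesis .
qed

text \<open>The bounds by \<open>h\<close> serve the right sides traversed in full; the signs serve
  the half sides at the bottom and at the top.\<close>

lemma rise_even_bounds:
  assumes "even n" "\<bar>s\<bar> \<le> w"
  shows "0 \<le> s \<Longrightarrow> 0 \<le> rise n s" "s \<le> 0 \<Longrightarrow> rise n s \<le> 0" "- h \<le> rise n s" "rise n s \<le> h"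
proof -
  define \<phi> where "\<phi> = s / r"
  have \<phi>: "- \<psi> \<le> \<phi>" "\<phi> \<le> \<psi>" using angle_bound[OF assms(2)] unfolding \<phi>_def by linarith+
  have rise: "rise n s = r\<^sup>2 / 2 * (\<phi> + sin \<phi>)" using rise_even[OF assms(1)] by (simp add: \<phi>_def)
  show "0 \<le> rise n s" if "0 \<le> s"
    unfolding rise using that r_pos \<phi> psi_less
    by (intro mult_nonneg_nonneg add_nonneg_nonneg sin_ge_zero) (auto simp: \<phi>_def)
  show "rise n s \<le> 0" if "s \<le> 0"
  proof -
    have "\<phi> \<le> 0" using that r_pos by (simp add: \<phi>_def divide_nonpos_pos)
    moreover from this have "0 \<le> sin (- \<phi>)" using \<phi> psi_less by (intro sin_ge_zero) auto
    ultimately show ?thesis unfolding rise by (intro mult_nonneg_nonpos) auto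
  qed
  have "sin \<phi> \<le> sin \<psi>" "sin (- \<psi>) \<le> sin \<phi>"
    using \<phi> psi_less psi_pos by (intro sin_monotone_2pi_le; simp)+
  then have "r\<^sup>2 / 2 * (\<phi> + sin \<phi>) \<le> r\<^sup>2 / 2 * (\<psi> + sin \<psi>)"
    "r\<^sup>2 / 2 * (- (\<psi> + sin \<psi>)) \<le> r\<^sup>2 / 2 * (\<phi> + sin \<phi>)"
    using \<phi> by (intro mult_left_mono; simp)+
  then show "- h \<le> rise n s" "rise n s \<le> h" unfolding rise using corner_rise_less_h by linarith+
qed

text \<open>The sides met are 0 to \<open>2 c\<close>, the first and the last only by half. A right
  side \<open>2 m\<close> has its midpoint at height \<open>m h\<close> and stays within
  \<open>h\<close> of it, which is enough unless \<open>m\<close> is 0 or \<open>c\<close>; there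
  the sign of the rise decides. A left side has its midpoint at \<open>m h + h / 2\<close> and stays
  within \<open>h / 2\<close>.\<close>

lemma lift_in_table:
  assumes "0 \<le> t" "t \<le> L"
  shows "lift t \<in> cyl_table d R H"
proof -
  define n s where "n = side t" and "s = t - 2 * of_int n * w"
  have s: "- w \<le> s" "s < w" "\<bar>s\<bar> \<le> w" using side_bounds[of t] by (auto simp: s_def n_def)
  have "- 1 * w < 2 * of_int n * w" "(2 * of_int n - 1) * w \<le> (4 * real c) * w"
    using s assms w_pos by (auto simp: s_def L_def algebra_simps)
  then have "- 1 < 2 * real_of_int n" "2 * real_of_int n - 1 \<le> 4 * real c"
    by (simp_all only: mult_less_cancel_right_pos[OF w_pos] mult_le_cancel_right_pos[OF w_pos])
  then have n: "0 \<le> n" "n \<le> 2 * int c" by linarith+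
  have "0 \<le> snd (piece n s) \<and> snd (piece n s) \<le> H"
  proof (cases "even n")
    case True
    then obtain m where m: "n = 2 * m" by blast
    note b = rise_even_bounds[OF True s(3)]
    have z: "snd (piece n s) = of_int m * h + rise n s" by (simp add: snd_piece m)
    have "0 \<le> snd (piece n s)"
    proof (cases "m = 0")
      case True
      then show ?thesis using b(1) assms z by (simp add: s_def m)
    next
      case False
      then have "1 * h \<le> of_int m * h" using n m h_pos by (intro mult_right_mono) auto
      then show ?thesis using b z by linarith
    qed
    moreover have "snd (piece n s) \<le> H"
    proof (cases "m = int c")
      case True
      then show ?thesis using b(2) assms z by (simp add: s_def m H_def L_def)
    next
      case False
      then have "of_int m * h \<le> (real c - 1) * h" using n m h_pos by (intro mult_right_mono) auto
      then show ?thesis using b z by (simp add: H_def algebra_simps)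
    qed
    ultimately show ?thesis ..
  next
    case False
    then obtain m where m: "n = 2 * m + 1" by (elim oddE)
    note b = rise_odd_bounds[OF False s(3)]
    have z: "snd (piece n s) = of_int m * h + h / 2 + rise n s" by (simp add: snd_piece m field_simps)
    have "0 * h \<le> of_int m * h" using n m h_pos by (intro mult_right_mono) auto
    moreover have "real_of_int (m + 1) \<le> of_int (int c)" unfolding of_int_le_iff using n m by simp
    then have "of_int m * h \<le> (real c - 1) * h" using h_pos by (intro mult_right_mono) auto
    ultimately show ?thesis using b z by (auto simp: H_def algebra_simps)
  qed
  then show ?thesis
    using arc_in_disc[OF s(3), of n] by (cases "piece n s") (auto simp: lift_def cyl_table_def n_def s_def simp del: mem_cball)
qed

lemma corner_height:
  assumes "0 \<le> n" "n < 2 * int c"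
  shows "0 < snd (piece n w)" "snd (piece n w) < H"
proof -
  have "0 < snd (piece n w) \<and> snd (piece n w) < H"
  proof (cases "even n")
    case True
    then obtain m where m: "n = 2 * m" by blast
    have z: "snd (piece n w) = of_int m * h + r\<^sup>2 / 2 * (\<psi> + sin \<psi>)"
      by (simp add: snd_piece m rise_even w_div_r)
    have "0 * h \<le> of_int m * h" using assms m h_pos by (intro mult_right_mono) auto
    moreover have "of_int m * h \<le> (real c - 1) * h" using assms m h_pos by (intro mult_right_mono) auto
    moreover have "0 < r\<^sup>2 / 2 * (\<psi> + sin \<psi>)"
      using r_pos psi_pos sin_pos by (intro mult_pos_pos add_pos_pos) auto
    ultimately show ?thesis using z corner_rise_less_h by (simp add: H_def left_diff_distrib)
  next
    case False
    then obtain m where m: "n = 2 * m + 1" by (elim oddE)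
    have z: "snd (piece n w) = of_int m * h + r\<^sup>2 / 2 * (3 * \<psi> - sin \<psi> - 2 * sin (2 * \<psi>))"
      using False sin_double[of \<psi>] by (simp add: snd_piece m rise_odd w_div_r h_def field_simps)
    have "0 * h \<le> of_int m * h" using assms m h_pos by (intro mult_right_mono) auto
    moreover have "of_int m * h \<le> (real c - 1) * h" using assms m h_pos by (intro mult_right_mono) auto
    moreover have "0 < r\<^sup>2 / 2 * (3 * \<psi> - sin \<psi> - 2 * sin (2 * \<psi>))"
      using r_pos clear_corner by (intro mult_pos_pos) auto
    moreover have "0 < r\<^sup>2 / 2 * (\<psi> + sin \<psi>)"
      using r_pos psi_pos sin_pos by (intro mult_pos_pos add_pos_pos) auto
    \<comment> \<open>The heights of the two vertices above the start of their lap add up to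
      \<open>h\<close>.\<close>
    then have "r\<^sup>2 / 2 * (3 * \<psi> - sin \<psi> - 2 * sin (2 * \<psi>)) < h"
      by (simp add: h_def algebra_simps)
    ultimately show ?thesis using z by (simp add: H_def left_diff_distrib)
  qed
  then show "0 < snd (piece n w)" "snd (piece n w) < H" by auto
qed

section \<open>Tangent planes at the bounce points\<close>

lemma fst_corner: "fst (piece n w) = (d, parity_sign n * R)"
  by (simp add: piece_def w_div_r R_def)

lemma corner_smooth:
  assumes "0 \<le> n" "n < 2 * int c"
  shows "smooth_boundary_point (cyl_table d R H) (piece n w)"
    and "tangent_vectors (frontier (cyl_table d R H)) (piece n w) = {v. cdy \<bullet> v = 0}"
proof -
  have q: "piece n w = ((d, parity_sign n * R), snd (piece n w))" by (simp add: prod_eq_iff fst_corner)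
  show tan: "tangent_vectors (frontier (cyl_table d R H)) (piece n w) = {v. cdy \<bullet> v = 0}"
    by (subst q) (intro tangent_vectors_wall R_pos parity_sign_mem corner_height assms)
  have "dist (d, 0) (d, parity_sign n * R) = R"
    using R_pos parity_sign_mem[of n] by (auto simp: dist_Pair_Pair dist_real_def)
  then have "piece n w \<in> frontier (cyl_table d R H)"
    by (subst q) (use corner_height[OF assms] in \<open>simp add: frontier_cyl_table\<close>)
  then show "smooth_boundary_point (cyl_table d R H) (piece n w)"
    using tan by (rule smooth_boundary_pointI) (simp add: cdy_def zero_prod_def)
qed

lemma pole_in_ball: "(2 * r, 0 :: real) \<in> ball (d, 0) R"
proof -
  have "(cos \<psi>)\<^sup>2 < cos \<psi>"
    using cos_pos cos_monotone_0_pi[of 0 \<psi>] psi_pos psi_less by (simp add: power2_eq_square)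
  then have "r\<^sup>2 * (2 * (cos \<psi>)\<^sup>2) < r\<^sup>2 * (2 * cos \<psi>)" using r_pos by (intro mult_strict_left_mono) auto
  moreover have "(2 * r - d)\<^sup>2 - R\<^sup>2 = r\<^sup>2 * (2 * (cos \<psi>)\<^sup>2) - r\<^sup>2 * (2 * cos \<psi>)"
    using sin_cos_squared_add2[of \<psi>] unfolding d_def R_def by algebra
  ultimately have "(2 * r - d)\<^sup>2 < R\<^sup>2" by linarith
  then show ?thesis by (simp add: mem_ball_plane[OF R_pos] del: mem_ball)
qed

lemma pole_smooth:
  assumes "z \<in> {0, H}"
  shows "smooth_boundary_point (cyl_table d R H) ((2 * r, 0), z)"
    and "tangent_vectors (frontier (cyl_table d R H)) ((2 * r, 0), z) = {v. cdz \<bullet> v = 0}"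
proof -
  show tan: "tangent_vectors (frontier (cyl_table d R H)) ((2 * r, 0), z) = {v. cdz \<bullet> v = 0}"
    by (intro tangent_vectors_lid pole_in_ball H_pos assms)
  have "(2 * r, 0 :: real) \<in> cball (d, 0) R" using pole_in_ball ball_subset_cball by blast
  then have "((2 * r, 0), z) \<in> frontier (cyl_table d R H)"
    unfolding frontier_cyl_table using assms H_pos by auto
  then show "smooth_boundary_point (cyl_table d R H) ((2 * r, 0), z)"
    using tan by (rule smooth_boundary_pointI) (simp add: cdz_def zero_prod_def)
qed

section \<open>The lift followed by its reversal\<close>

definition orbit :: "real \<Rightarrow> space" where "orbit = gamma_orbit d \<psi> c"

definition orbit_momentum :: "real \<Rightarrow> space" where
  "orbit_momentum t = (let s = t rmod (2 * L) in if s \<le> L then lifted_momentum s else - lifted_momentum (2 * L - s))"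

text \<open>As \<open>L = 4 c w\<close>, the vertices met on the reversal again fall on odd
  multiples of \<open>w\<close>.\<close>

definition bounce_times :: "real set" where
  "bounce_times = {t. \<exists>k::int. t = of_int k * L \<or> t = of_int (2 * k + 1) * w}"

lemma orbit_eq: "orbit t = (let s = t rmod (2 * L) in if s \<le> L then lift s else lift (2 * L - s))"
proof -
  have "0 \<le> t rmod (2 * L)" "t rmod (2 * L) < 2 * L" using L_pos by (auto intro: rmod_nonneg rmod_less)
  then show ?thesis
    by (auto simp: orbit_def gamma_orbit_def there_and_back_def lap_eq L_def[symmetric] Let_def hlift_eq)
qed

lemma orbit_forward:
  assumes "2 * of_int j * L \<le> t" "t \<le> (2 * of_int j + 1) * L"
  shows "orbit t = lift (t - 2 * of_int j * L)" "orbit_momentum t = lifted_momentum (t - 2 * of_int j * L)"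
proof -
  have "t rmod (2 * L) = t - 2 * of_int j * L"
    using assms L_pos by (intro rmod_unique[where n = j]) (auto simp: algebra_simps)
  moreover have "t - 2 * of_int j * L \<le> L" using assms by (simp add: algebra_simps)
  ultimately show "orbit t = lift (t - 2 * of_int j * L)" "orbit_momentum t = lifted_momentum (t - 2 * of_int j * L)"
    by (simp_all add: orbit_eq orbit_momentum_def)
qed

lemma orbit_backward_aux:
  assumes "(2 * of_int j + 1) * L < t" "t < (2 * of_int j + 2) * L"
  shows "orbit t = lift ((2 * of_int j + 2) * L - t)"
    "orbit_momentum t = - lifted_momentum ((2 * of_int j + 2) * L - t)"
proof -
  have "t rmod (2 * L) = t - 2 * of_int j * L"
    using assms L_pos by (intro rmod_unique[where n = j]) (auto simp: algebra_simps)
  moreover have "\<not> t - 2 * of_int j * L \<le> L" using assms by (simp add: algebra_simps)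
  moreover have "2 * L - (t - 2 * of_int j * L) = (2 * of_int j + 2) * L - t" by (simp add: algebra_simps)
  ultimately show "orbit t = lift ((2 * of_int j + 2) * L - t)"
    "orbit_momentum t = - lifted_momentum ((2 * of_int j + 2) * L - t)"
    by (simp_all only: orbit_eq orbit_momentum_def Let_def if_False)
qed

text \<open>At the two turning times the forward formula gives the same position, so the interval is
  closed here; the momentum changes sign there, whence the open interval in
  \<open>orbit_backward_aux\<close>.\<close>

lemma orbit_backward:
  assumes "(2 * of_int j + 1) * L \<le> t" "t \<le> (2 * of_int j + 2) * L"
  shows "orbit t = lift ((2 * of_int j + 2) * L - t)"
proof -
  consider "t = (2 * of_int j + 1) * L" | "t = (2 * of_int j + 2) * L"
    | "(2 * of_int j + 1) * L < t" "t < (2 * of_int j + 2) * L" using assms by linarith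
  then show ?thesis
  proof cases
    case 1
    then show ?thesis using L_pos orbit_forward(1)[of j t] by (simp add: algebra_simps)
  next
    case 2
    then show ?thesis using L_pos orbit_forward(1)[of "j + 1" t] by (simp add: algebra_simps)
  qed (rule orbit_backward_aux)
qed

lemma lap_containing:
  obtains j :: int where "2 * of_int j * L \<le> t" "t < (2 * of_int j + 2) * L"
proof (rule that[of "\<lfloor>t / (2 * L)\<rfloor>"])
  show "2 * of_int \<lfloor>t / (2 * L)\<rfloor> * L \<le> t" "t < (2 * of_int \<lfloor>t / (2 * L)\<rfloor> + 2) * L"
    using floor_divide_lower[of "2 * L" t] floor_divide_upper[of "2 * L" t] L_pos by (simp_all add: algebra_simps)
qed

lemma orbit_in_table: "orbit t \<in> cyl_table d R H"
proof -
  obtain j :: int where j: "2 * of_int j * L \<le> t" "t < (2 * of_int j + 2) * L" by (rule lap_containing)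
  show ?thesis
  proof (cases "t \<le> (2 * of_int j + 1) * L")
    case True
    then show ?thesis using j by (auto simp: orbit_forward algebra_simps intro!: lift_in_table)
  next
    case False
    then show ?thesis
      using j by (subst orbit_backward[of j]) (auto simp: algebra_simps intro!: lift_in_table)
  qed
qed

lemma orbit_periodic: "orbit (t + 2 * L) = orbit t"
proof -
  have "(t + 2 * L) rmod (2 * L) = t rmod (2 * L)"
  proof (rule rmod_unique[where n = "\<lfloor>t / (2 * L)\<rfloor> + 1"])
    show "t rmod (2 * L) \<in> {0..<\<bar>2 * L\<bar>}" using L_pos by (auto intro: rmod_nonneg rmod_less)
    show "t + 2 * L = t rmod (2 * L) + of_int (\<lfloor>t / (2 * L)\<rfloor> + 1) * (2 * L)"
      using L_pos by (simp add: rmod_def algebra_simps)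
  qed
  then show ?thesis by (simp add: orbit_eq)
qed

text \<open>The sign \<open>\<sigma>\<close> is \<open>1\<close> on the way up and \<open>- 1\<close> on the reversal, where the momentum is negated.\<close>

definition follows :: "real filter \<Rightarrow> int \<Rightarrow> real \<Rightarrow> real \<Rightarrow> bool" where
  "follows F n \<sigma> C \<longleftrightarrow>
    (\<forall>\<^sub>F u in F. orbit u = piece n (\<sigma> * u + C) \<and> orbit_momentum u = \<sigma> *\<^sub>R momentum n (\<sigma> * u + C))"

text \<open>The filter is left arbitrary: \<open>nhds t\<close> yields Hamilton's equations between
  bounces, the one-sided filters yield the limits at a bounce.\<close>

lemma follows_forward:
  assumes "\<forall>\<^sub>F u in F. u \<in> {2 * of_int j * L<..<(2 * of_int j + 1) * L} \<and>
    u \<in> {2 * of_int j * L + (2 * of_int n - 1) * w<..<2 * of_int j * L + (2 * of_int n + 1) * w}"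
  shows "follows F n 1 (- (2 * of_int j * L + 2 * of_int n * w))"
  unfolding follows_def using assms
proof eventually_elim
  case (elim u)
  then have b: "- w < u - 2 * of_int j * L - 2 * of_int n * w" "u - 2 * of_int j * L - 2 * of_int n * w < w"
    by (auto simp: algebra_simps)
  have eq: "1 * u + - (2 * of_int j * L + 2 * of_int n * w) = u - 2 * of_int j * L - 2 * of_int n * w" by simp
  show ?case
    unfolding eq using elim b orbit_forward[of j u] lift_eq[of "u - 2 * of_int j * L" n]
      lifted_momentum_eq[of "u - 2 * of_int j * L" n] by simp
qed

lemma follows_backward:
  assumes "\<forall>\<^sub>F u in F. u \<in> {(2 * of_int j + 1) * L<..<(2 * of_int j + 2) * L} \<and>
    u \<in> {(2 * of_int j + 2) * L - (2 * of_int n + 1) * w<..<(2 * of_int j + 2) * L - (2 * of_int n - 1) * w}"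
  shows "follows F n (- 1) ((2 * of_int j + 2) * L - 2 * of_int n * w)"
  unfolding follows_def using assms
proof eventually_elim
  case (elim u)
  then have b: "- w < (2 * of_int j + 2) * L - u - 2 * of_int n * w" "(2 * of_int j + 2) * L - u - 2 * of_int n * w < w"
    by (auto simp: algebra_simps)
  have eq: "- 1 * u + ((2 * of_int j + 2) * L - 2 * of_int n * w) = (2 * of_int j + 2) * L - u - 2 * of_int n * w" by simp
  show ?case
    unfolding eq using elim b orbit_backward_aux[of j u] lift_eq[of "(2 * of_int j + 2) * L - u" n]
      lifted_momentum_eq[of "(2 * of_int j + 2) * L - u" n] by simp
qed

lemma follows_tendsto:
  assumes "follows (at t within S) n \<sigma> C"
  shows "(orbit \<longlongrightarrow> piece n (\<sigma> * t + C)) (at t within S)"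
    "(orbit_momentum \<longlongrightarrow> \<sigma> *\<^sub>R momentum n (\<sigma> * t + C)) (at t within S)"
proof -
  have aff: "((\<lambda>u. \<sigma> * u + C) \<longlongrightarrow> \<sigma> * t + C) (at t within S)" by (intro tendsto_intros)
  have "((\<lambda>u. piece n (\<sigma> * u + C)) \<longlongrightarrow> piece n (\<sigma> * t + C)) (at t within S)"
    by (rule isCont_tendsto_compose[OF isCont_piece aff])
  then show "(orbit \<longlongrightarrow> piece n (\<sigma> * t + C)) (at t within S)"
    by (rule Lim_transform_eventually) (use assms in \<open>auto simp: follows_def elim: eventually_mono\<close>)
  have "((\<lambda>u. \<sigma> *\<^sub>R momentum n (\<sigma> * u + C)) \<longlongrightarrow> \<sigma> *\<^sub>R momentum n (\<sigma> * t + C)) (at t within S)"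
    by (intro tendsto_scaleR tendsto_const isCont_tendsto_compose[OF isCont_momentum aff])
  then show "(orbit_momentum \<longlongrightarrow> \<sigma> *\<^sub>R momentum n (\<sigma> * t + C)) (at t within S)"
    by (rule Lim_transform_eventually) (use assms in \<open>auto simp: follows_def elim: eventually_mono\<close>)
qed

lemma follows_hamilton:
  assumes "follows (nhds t) n \<sigma> C" "\<sigma> \<in> {1, -1}"
  shows "orbit_momentum t \<in> unit_covectors (orbit t)" "hamilton_eq_at orbit orbit_momentum t"
  using hamilton_arc[OF assms(2) assms(1)[unfolded follows_def]] by simp_all

lemma L_eq: "L = of_int (4 * int c) * w"
  by (simp add: L_def)

lemma bounce_timesI:
  "of_int k * L \<in> bounce_times" "of_int (2 * k + 1) * w \<in> bounce_times"
  by (auto simp: bounce_times_def)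

lemma follows_off_bounces:
  assumes "t \<notin> bounce_times"
  obtains n \<sigma> C where "\<sigma> \<in> {1, -1}" "follows (nhds t) n \<sigma> C"
proof -
  obtain j :: int where j: "2 * of_int j * L \<le> t" "t < (2 * of_int j + 2) * L" by (rule lap_containing)
  have ne: "t \<noteq> 2 * of_int j * L" "t \<noteq> (2 * of_int j + 1) * L"
    using assms bounce_timesI(1)[of "2 * j"] bounce_timesI(1)[of "2 * j + 1"] by auto
  show ?thesis
  proof (cases "t < (2 * of_int j + 1) * L")
    case True
    define n where "n = side (t - 2 * of_int j * L)"
    have "t \<noteq> 2 * of_int j * L + (2 * of_int n - 1) * w"
    proof
      assume "t = 2 * of_int j * L + (2 * of_int n - 1) * w"
      then have "t = of_int (2 * (4 * int c * j + n - 1) + 1) * w" by (simp add: L_eq algebra_simps)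
      then show False using assms bounce_timesI(2) by metis
    qed
    then have "t \<in> {2 * of_int j * L<..<(2 * of_int j + 1) * L} \<inter>
        {2 * of_int j * L + (2 * of_int n - 1) * w<..<2 * of_int j * L + (2 * of_int n + 1) * w}"
      using side_bounds[of "t - 2 * of_int j * L"] j True ne by (auto simp: n_def algebra_simps)
    from eventually_nhds_in_open[OF open_Int[OF open_greaterThanLessThan open_greaterThanLessThan] this]
    have "follows (nhds t) n 1 (- (2 * of_int j * L + 2 * of_int n * w))"
      unfolding Int_iff by (rule follows_forward)
    then show ?thesis by (rule that[rotated]) simp
  next
    case False
    define n where "n = side ((2 * of_int j + 2) * L - t)"
    have "t \<noteq> (2 * of_int j + 2) * L - (2 * of_int n - 1) * w"
    proof
      assume "t = (2 * of_int j + 2) * L - (2 * of_int n - 1) * w"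
      then have "t = of_int (2 * (4 * int c * (j + 1) - n) + 1) * w" by (simp add: L_eq algebra_simps)
      then show False using assms bounce_timesI(2) by metis
    qed
    then have "t \<in> {(2 * of_int j + 1) * L<..<(2 * of_int j + 2) * L} \<inter>
        {(2 * of_int j + 2) * L - (2 * of_int n + 1) * w<..<(2 * of_int j + 2) * L - (2 * of_int n - 1) * w}"
      using side_bounds[of "(2 * of_int j + 2) * L - t"] j False ne by (auto simp: n_def algebra_simps)
    from eventually_nhds_in_open[OF open_Int[OF open_greaterThanLessThan open_greaterThanLessThan] this]
    have "follows (nhds t) n (- 1) ((2 * of_int j + 2) * L - 2 * of_int n * w)"
      unfolding Int_iff by (rule follows_backward)
    then show ?thesis by (rule that[rotated]) simp
  qed
qed

text \<open>A bounce is the end of one arc and the start of another. In this lemma and the next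
  three, the intervals for \<open>t\<close> are therefore closed at the end that the one-sided
  filter approaches from within.\<close>

lemma follows_forward_left:
  assumes "2 * of_int j * L < t" "t \<le> (2 * of_int j + 1) * L"
    "2 * of_int j * L + (2 * of_int n - 1) * w < t" "t \<le> 2 * of_int j * L + (2 * of_int n + 1) * w"
  shows "follows (at_left t) n 1 (- (2 * of_int j * L + 2 * of_int n * w))"
proof (rule follows_forward)
  have "\<forall>\<^sub>F u in at_left t. u \<in> {2 * of_int j * L<..<t} \<and> u \<in> {2 * of_int j * L + (2 * of_int n - 1) * w<..<t}"
    using assms by (intro eventually_conj eventually_at_left_real)
  then show "\<forall>\<^sub>F u in at_left t. u \<in> {2 * of_int j * L<..<(2 * of_int j + 1) * L} \<and>
      u \<in> {2 * of_int j * L + (2 * of_int n - 1) * w<..<2 * of_int j * L + (2 * of_int n + 1) * w}"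
    by eventually_elim (use assms in auto)
qed

lemma follows_forward_right:
  assumes "2 * of_int j * L \<le> t" "t < (2 * of_int j + 1) * L"
    "2 * of_int j * L + (2 * of_int n - 1) * w \<le> t" "t < 2 * of_int j * L + (2 * of_int n + 1) * w"
  shows "follows (at_right t) n 1 (- (2 * of_int j * L + 2 * of_int n * w))"
proof (rule follows_forward)
  have "\<forall>\<^sub>F u in at_right t. u \<in> {t<..<(2 * of_int j + 1) * L} \<and>
      u \<in> {t<..<2 * of_int j * L + (2 * of_int n + 1) * w}"
    using assms by (intro eventually_conj eventually_at_right_real)
  then show "\<forall>\<^sub>F u in at_right t. u \<in> {2 * of_int j * L<..<(2 * of_int j + 1) * L} \<and>
      u \<in> {2 * of_int j * L + (2 * of_int n - 1) * w<..<2 * of_int j * L + (2 * of_int n + 1) * w}"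
    by eventually_elim (use assms in auto)
qed

lemma follows_backward_left:
  assumes "(2 * of_int j + 1) * L < t" "t \<le> (2 * of_int j + 2) * L"
    "(2 * of_int j + 2) * L - (2 * of_int n + 1) * w < t" "t \<le> (2 * of_int j + 2) * L - (2 * of_int n - 1) * w"
  shows "follows (at_left t) n (- 1) ((2 * of_int j + 2) * L - 2 * of_int n * w)"
proof (rule follows_backward)
  have "\<forall>\<^sub>F u in at_left t. u \<in> {(2 * of_int j + 1) * L<..<t} \<and>
      u \<in> {(2 * of_int j + 2) * L - (2 * of_int n + 1) * w<..<t}"
    using assms by (intro eventually_conj eventually_at_left_real)
  then show "\<forall>\<^sub>F u in at_left t. u \<in> {(2 * of_int j + 1) * L<..<(2 * of_int j + 2) * L} \<and>
      u \<in> {(2 * of_int j + 2) * L - (2 * of_int n + 1) * w<..<(2 * of_int j + 2) * L - (2 * of_int n - 1) * w}"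
    by eventually_elim (use assms in auto)
qed

lemma follows_backward_right:
  assumes "(2 * of_int j + 1) * L \<le> t" "t < (2 * of_int j + 2) * L"
    "(2 * of_int j + 2) * L - (2 * of_int n + 1) * w \<le> t" "t < (2 * of_int j + 2) * L - (2 * of_int n - 1) * w"
  shows "follows (at_right t) n (- 1) ((2 * of_int j + 2) * L - 2 * of_int n * w)"
proof (rule follows_backward)
  have "\<forall>\<^sub>F u in at_right t. u \<in> {t<..<(2 * of_int j + 2) * L} \<and>
      u \<in> {t<..<(2 * of_int j + 2) * L - (2 * of_int n - 1) * w}"
    using assms by (intro eventually_conj eventually_at_right_real)
  then show "\<forall>\<^sub>F u in at_right t. u \<in> {(2 * of_int j + 1) * L<..<(2 * of_int j + 2) * L} \<and>
      u \<in> {(2 * of_int j + 2) * L - (2 * of_int n + 1) * w<..<(2 * of_int j + 2) * L - (2 * of_int n - 1) * w}"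
    by eventually_elim (use assms in auto)
qed

lemma bounce_times_cases:
  assumes "t \<in> bounce_times"
  obtains (bottom) j :: int where "t = 2 * of_int j * L"
    | (top) j :: int where "t = (2 * of_int j + 1) * L"
    | (corner_forward) j n :: int where "0 \<le> n" "n < 2 * int c" "t = 2 * of_int j * L + (2 * of_int n + 1) * w"
    | (corner_backward) j n :: int where "0 \<le> n" "n < 2 * int c"
        "t = (2 * of_int j + 2) * L - (2 * of_int n + 1) * w"
proof -
  consider k :: int where "t = of_int k * L" | k :: int where "t = of_int (2 * k + 1) * w"
    using assms by (auto simp: bounce_times_def)
  then show ?thesis
  proof cases
    case 1
    show ?thesis
    proof (cases "even k")
      case True
      then obtain j where "k = 2 * j" by blast
      then show ?thesis using bottom[of j] 1 by simp
    next
      case False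
      then obtain j where "k = 2 * j + 1" by (elim oddE)
      then show ?thesis using top[of j] 1 by simp
    qed
  next
    case 2
    obtain j :: int where j: "2 * of_int j * L \<le> t" "t < (2 * of_int j + 2) * L" by (rule lap_containing)
    define a where "a = 4 * int c * j"
    have jL: "2 * of_int j * L = of_int (2 * a) * w" "(2 * of_int j + 1) * L = of_int (2 * a + 4 * int c) * w"
      "(2 * of_int j + 2) * L = of_int (2 * a + 8 * int c) * w"
      by (simp_all add: L_eq a_def algebra_simps)
    have "2 * a \<le> 2 * k + 1" "2 * k + 1 < 2 * a + 8 * int c"
      using j unfolding 2 jL mult_le_cancel_right_pos[OF w_pos] mult_less_cancel_right_pos[OF w_pos]
        of_int_le_iff of_int_less_iff by auto
    show ?thesis
    proof (cases "2 * k + 1 < 2 * a + 4 * int c")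
      case True
      have "t = 2 * of_int j * L + (2 * of_int (k - a) + 1) * w"
        unfolding 2 jL by (simp add: algebra_simps)
      then show ?thesis using \<open>2 * a \<le> 2 * k + 1\<close> True by (intro corner_forward[of "k - a" j]) auto
    next
      case False
      \<comment> \<open>On the reversal the odd multiple is counted down from the end of the period:
        \<open>2 k + 1 = 2 a + 8 c - (2 n + 1)\<close>.\<close>
      have "t = (2 * of_int j + 2) * L - (2 * of_int (a + 4 * int c - k - 1) + 1) * w"
        unfolding 2 jL by (simp add: algebra_simps)
      then show ?thesis using \<open>2 * k + 1 < 2 * a + 8 * int c\<close> False
        by (intro corner_backward[of "a + 4 * int c - k - 1" j]) auto
    qed
  qed
qed

text \<open>An arc extends beyond the ends of its side, so \<open>hamilton_arc\<close> applies to
  the arc itself even at a vertex; this makes the one-sided limits at bounces unit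
  covectors.\<close>

lemma momentum_unit:
  assumes "\<sigma> \<in> {1, -1}"
  shows "\<sigma> *\<^sub>R momentum n s \<in> unit_covectors (piece n s)"
  using hamilton_arc[OF assms, where t = 0 and q = "\<lambda>u. piece n (\<sigma> * u + s)" and n = n and C = s
      and p = "\<lambda>u. \<sigma> *\<^sub>R momentum n (\<sigma> * u + s)"]
  by simp

lemma momentum_pole: "even n \<Longrightarrow> momentum n 0 = (1 / r) *\<^sub>R cdz"
  by (simp add: momentum_def parity_sign_def cdz_def)

text \<open>The usual reflection law: at the vertex the incoming and outgoing planar velocities
  differ only in the sign of the dy part, and the \<alpha>-components cancel.\<close>

lemma momentum_corner: "momentum n w - momentum (n + 1) (- w) = (2 * parity_sign n * cos \<psi>) *\<^sub>R cdy"
  by (simp add: momentum_def parity_sign_Suc w_div_r cdy_def) (simp add: field_simps)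

lemma cd_nonzero: "cdy \<noteq> 0" "cdz \<noteq> 0"
  by (simp_all add: cdy_def cdz_def zero_prod_def)

section \<open>The reflection law at every bounce\<close>

definition reflects_at :: "real \<Rightarrow> bool" where
  "reflects_at t \<longleftrightarrow> isCont orbit t \<and> smooth_boundary_point (cyl_table d R H) (orbit t) \<and>
    (\<exists>lin lout. (orbit_momentum \<longlongrightarrow> lin) (at_left t) \<and> (orbit_momentum \<longlongrightarrow> lout) (at_right t) \<and>
      lin \<noteq> lout \<and> lin \<in> unit_covectors (orbit t) \<and> lout \<in> unit_covectors (orbit t) \<and>
      lin - lout \<in> Ann (tangent_vectors (frontier (cyl_table d R H)) (orbit t)))"

lemma reflects_atI:
  assumes follows: "follows (at_left t) n \<sigma> C" "follows (at_right t) n' \<sigma>' C'"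
    and signs: "\<sigma> \<in> {1, -1}" "\<sigma>' \<in> {1, -1}"
    and s: "\<sigma> * t + C = s" "\<sigma>' * t + C' = s'"
    and orbit: "orbit t = piece n s" "orbit t = piece n' s'"
    and smooth: "smooth_boundary_point (cyl_table d R H) (orbit t)"
    and tangent: "tangent_vectors (frontier (cyl_table d R H)) (orbit t) = {v. N \<bullet> v = 0}"
    and jump: "\<sigma> *\<^sub>R momentum n s - \<sigma>' *\<^sub>R momentum n' s' = k *\<^sub>R N" "k \<noteq> 0" "N \<noteq> 0"
  shows "reflects_at t"
  unfolding reflects_at_def
proof (intro conjI exI smooth)
  show "isCont orbit t"
    using follows_tendsto(1)[OF follows(1)] follows_tendsto(1)[OF follows(2)]
    unfolding s orbit[symmetric] by (simp add: continuous_at_split continuous_within[of t _ orbit])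
  show "(orbit_momentum \<longlongrightarrow> \<sigma> *\<^sub>R momentum n s) (at_left t)"
    "(orbit_momentum \<longlongrightarrow> \<sigma>' *\<^sub>R momentum n' s') (at_right t)"
    using follows_tendsto(2)[OF follows(1)] follows_tendsto(2)[OF follows(2)] by (simp_all only: s)
  show "\<sigma> *\<^sub>R momentum n s \<in> unit_covectors (orbit t)"
    unfolding orbit(1) by (rule momentum_unit[OF signs(1)])
  show "\<sigma>' *\<^sub>R momentum n' s' \<in> unit_covectors (orbit t)"
    unfolding orbit(2) by (rule momentum_unit[OF signs(2)])
  have "k *\<^sub>R N \<noteq> 0" using jump by simp
  then show "\<sigma> *\<^sub>R momentum n s \<noteq> \<sigma>' *\<^sub>R momentum n' s'" unfolding jump(1)[symmetric] by simp
  show "\<sigma> *\<^sub>R momentum n s - \<sigma>' *\<^sub>R momentum n' s' \<in>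
      Ann (tangent_vectors (frontier (cyl_table d R H)) (orbit t))"
    unfolding jump(1) tangent by (simp add: Ann_def)
qed

lemma lift_L: "lift L = ((2 * r, 0), H)"
  using lift_lap[of c] by (simp add: L_def H_def)

lemma piece_0: "piece 0 0 = ((2 * r, 0), 0)" "piece (2 * int c) 0 = ((2 * r, 0), H)"
  by (simp_all add: piece_def parity_sign_def d_def H_def)

lemma L_side: "L = 2 * of_int (2 * int c) * w"
  by (simp add: L_def)

lemma orbit_bottom: "orbit (2 * of_int j * L) = ((2 * r, 0), 0)"
  using orbit_forward(1)[of j "2 * of_int j * L"] L_pos by (simp add: lift_0 algebra_simps)

lemma orbit_top: "orbit ((2 * of_int j + 1) * L) = ((2 * r, 0), H)"
  using orbit_forward(1)[of j "(2 * of_int j + 1) * L"] L_pos by (simp add: lift_L algebra_simps)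

lemma corner_time_bounds:
  assumes "0 \<le> n" "n < 2 * int c"
  shows "w \<le> (2 * of_int n + 1) * w" "(2 * of_int n + 1) * w \<le> L - w"
proof -
  have "1 * w \<le> (2 * of_int n + 1) * w" using assms w_pos by (intro mult_right_mono) auto
  then show "w \<le> (2 * of_int n + 1) * w" by simp
  have "real_of_int (2 * n + 1) \<le> of_int (4 * int c - 1)" unfolding of_int_le_iff using assms by simp
  then have "(2 * of_int n + 1) * w \<le> (4 * real c - 1) * w" using w_pos by (intro mult_right_mono) auto
  then show "(2 * of_int n + 1) * w \<le> L - w" by (simp add: L_def algebra_simps)
qed

lemma lift_corner: "lift ((2 * of_int n + 1) * w) = piece n w"
  using lift_eq[of "(2 * of_int n + 1) * w" n] w_pos by (simp add: algebra_simps)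

lemma orbit_corner_forward:
  assumes "0 \<le> n" "n < 2 * int c"
  shows "orbit (2 * of_int j * L + (2 * of_int n + 1) * w) = piece n w"
  using orbit_forward(1)[of j "2 * of_int j * L + (2 * of_int n + 1) * w"] corner_time_bounds[OF assms] w_pos
    lift_corner[of n]
  by (simp add: distrib_right)

lemma orbit_corner_backward:
  assumes "0 \<le> n" "n < 2 * int c"
  shows "orbit ((2 * of_int j + 2) * L - (2 * of_int n + 1) * w) = piece n w"
  using orbit_backward[of j "(2 * of_int j + 2) * L - (2 * of_int n + 1) * w"] corner_time_bounds[OF assms] w_pos
    lift_corner[of n]
  by (simp add: distrib_right)

lemma reflects_at_bounce:
  assumes "t \<in> bounce_times"
  shows "reflects_at t"
  using assms
proof (cases rule: bounce_times_cases)
  case (bottom j)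
  \<comment> \<open>The incoming arc belongs to the reversal in the preceding period, hence
    \<open>j - 1\<close>. The momentum passes from \<open>- dz / r\<close> to
    \<open>dz / r\<close>.\<close>
  have "follows (at_left t) 0 (- 1) ((2 * of_int (j - 1) + 2) * L - 2 * of_int 0 * w)"
    by (rule follows_backward_left) (use bottom L_pos w_pos in \<open>simp_all add: algebra_simps\<close>)
  moreover have "follows (at_right t) 0 1 (- (2 * of_int j * L + 2 * of_int 0 * w))"
    by (rule follows_forward_right) (use bottom L_pos w_pos in \<open>simp_all add: algebra_simps\<close>)
  ultimately show ?thesis
  proof (rule reflects_atI[where s = 0 and s' = 0 and N = cdz and k = "- 2 / r"])
    show "tangent_vectors (frontier (cyl_table d R H)) (orbit t) = {v. cdz \<bullet> v = 0}"
      unfolding bottom orbit_bottom by (rule pole_smooth) simp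
    show "smooth_boundary_point (cyl_table d R H) (orbit t)"
      unfolding bottom orbit_bottom by (rule pole_smooth) simp
    show "- 1 *\<^sub>R momentum 0 0 - 1 *\<^sub>R momentum 0 0 = (- 2 / r) *\<^sub>R cdz"
      using r_pos by (simp add: momentum_pole cdz_def zero_prod_def)
    show "orbit t = piece 0 0" "orbit t = piece 0 0"
      unfolding bottom orbit_bottom piece_0 by (rule refl)+
  qed (use bottom r_pos in \<open>simp_all add: algebra_simps cd_nonzero\<close>)
next
  case (top j)
  have m: "(2 * real_of_int (2 * int c) - 1) * w = L - w" "(2 * real_of_int (2 * int c) + 1) * w = L + w"
    by (simp_all add: L_def algebra_simps)
  \<comment> \<open>Both arcs are the first half of side \<open>2 c\<close>, run forwards into the
    top and then backwards.\<close>
  have "follows (at_left t) (2 * int c) 1 (- (2 * of_int j * L + 2 * of_int (2 * int c) * w))"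
    by (rule follows_forward_left; unfold m top) (use L_pos w_pos in \<open>simp_all add: algebra_simps\<close>)
  moreover have "follows (at_right t) (2 * int c) (- 1) ((2 * of_int j + 2) * L - 2 * of_int (2 * int c) * w)"
    by (rule follows_backward_right; unfold m top) (use L_pos w_pos in \<open>simp_all add: algebra_simps\<close>)
  ultimately show ?thesis
  proof (rule reflects_atI[where s = 0 and s' = 0 and N = cdz and k = "2 / r"])
    show "tangent_vectors (frontier (cyl_table d R H)) (orbit t) = {v. cdz \<bullet> v = 0}"
      unfolding top orbit_top by (rule pole_smooth) simp
    show "smooth_boundary_point (cyl_table d R H) (orbit t)"
      unfolding top orbit_top by (rule pole_smooth) simp
    show "1 *\<^sub>R momentum (2 * int c) 0 - - 1 *\<^sub>R momentum (2 * int c) 0 = (2 / r) *\<^sub>R cdz"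
      using r_pos by (simp add: momentum_pole cdz_def zero_prod_def)
    show "1 * t + - (2 * of_int j * L + 2 * of_int (2 * int c) * w) = 0"
      "- 1 * t + ((2 * of_int j + 2) * L - 2 * of_int (2 * int c) * w) = 0"
      unfolding top L_side[symmetric] by (simp_all add: algebra_simps)
  qed (use top r_pos in \<open>simp_all add: orbit_top piece_0 cd_nonzero\<close>)
next
  case (corner_forward j n)
  \<comment> \<open>With \<open>n w\<close> and \<open>j L\<close> as atoms, all conditions on the
    times become linear.\<close>
  define x y where "x = of_int n * w" and "y = of_int j * L"
  have e: "(2 * of_int n + 1) * w = 2 * x + w" "(2 * of_int n - 1) * w = 2 * x - w"
    "(2 * of_int (n + 1) + 1) * w = 2 * x + 3 * w" "(2 * of_int (n + 1) - 1) * w = 2 * x + w"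
    "2 * of_int j * L = 2 * y" "(2 * of_int j + 1) * L = 2 * y + L" "(2 * of_int j + 2) * L = 2 * y + 2 * L"
    by (simp_all add: x_def y_def algebra_simps)
  note b = corner_time_bounds[OF corner_forward(1,2), unfolded e]
  have q: "orbit t = piece n w" unfolding corner_forward(3) using corner_forward(1,2) by (rule orbit_corner_forward)
  have "follows (at_left t) n 1 (- (2 * of_int j * L + 2 * of_int n * w))"
    by (rule follows_forward_left; unfold corner_forward(3) e; use b w_pos in linarith)
  moreover have "follows (at_right t) (n + 1) 1 (- (2 * of_int j * L + 2 * of_int (n + 1) * w))"
    by (rule follows_forward_right; unfold corner_forward(3) e; use b w_pos in linarith)
  ultimately show ?thesis
  proof (rule reflects_atI[where s = w and s' = "- w" and N = cdy and k = "2 * parity_sign n * cos \<psi>"])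
    show "1 *\<^sub>R momentum n w - 1 *\<^sub>R momentum (n + 1) (- w) = (2 * parity_sign n * cos \<psi>) *\<^sub>R cdy"
      by (simp only: momentum_corner scaleR_one)
    show "orbit t = piece n w" "orbit t = piece (n + 1) (- w)"
      unfolding arc_corner[symmetric] by (fact q)+
    show "smooth_boundary_point (cyl_table d R H) (orbit t)"
      "tangent_vectors (frontier (cyl_table d R H)) (orbit t) = {v. cdy \<bullet> v = 0}"
      unfolding q using corner_forward(1,2) by (rule corner_smooth)+
    show "2 * parity_sign n * cos \<psi> \<noteq> 0" using cos_pos parity_sign_mem[of n] by auto
  qed (simp_all add: corner_forward(3) cd_nonzero algebra_simps)
next
  case (corner_backward j n)
  define x y where "x = of_int n * w" and "y = of_int j * L"
  have e: "(2 * of_int n + 1) * w = 2 * x + w" "(2 * of_int n - 1) * w = 2 * x - w"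
    "(2 * of_int (n + 1) + 1) * w = 2 * x + 3 * w" "(2 * of_int (n + 1) - 1) * w = 2 * x + w"
    "2 * of_int j * L = 2 * y" "(2 * of_int j + 1) * L = 2 * y + L" "(2 * of_int j + 2) * L = 2 * y + 2 * L"
    by (simp_all add: x_def y_def algebra_simps)
  note b = corner_time_bounds[OF corner_backward(1,2), unfolded e]
  have q: "orbit t = piece n w" unfolding corner_backward(3) using corner_backward(1,2) by (rule orbit_corner_backward)
  have "follows (at_left t) (n + 1) (- 1) ((2 * of_int j + 2) * L - 2 * of_int (n + 1) * w)"
    by (rule follows_backward_left; unfold corner_backward(3) e; use b w_pos in linarith)
  moreover have "follows (at_right t) n (- 1) ((2 * of_int j + 2) * L - 2 * of_int n * w)"
    by (rule follows_backward_right; unfold corner_backward(3) e; use b w_pos in linarith)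
  ultimately show ?thesis
  proof (rule reflects_atI[where s = "- w" and s' = w and N = cdy and k = "2 * parity_sign n * cos \<psi>"])
    have "- 1 *\<^sub>R momentum (n + 1) (- w) - - 1 *\<^sub>R momentum n w = momentum n w - momentum (n + 1) (- w)" by simp
    then show "- 1 *\<^sub>R momentum (n + 1) (- w) - - 1 *\<^sub>R momentum n w = (2 * parity_sign n * cos \<psi>) *\<^sub>R cdy"
      by (simp only: momentum_corner)
    show "orbit t = piece n w" "orbit t = piece (n + 1) (- w)"
      unfolding arc_corner[symmetric] by (fact q)+
    show "smooth_boundary_point (cyl_table d R H) (orbit t)"
      "tangent_vectors (frontier (cyl_table d R H)) (orbit t) = {v. cdy \<bullet> v = 0}"
      unfolding q using corner_backward(1,2) by (rule corner_smooth)+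
    show "2 * parity_sign n * cos \<psi> \<noteq> 0" using cos_pos parity_sign_mem[of n] by auto
  qed (simp_all add: corner_backward(3) cd_nonzero algebra_simps)
qed

lemma isCont_orbit: "isCont orbit t"
proof (cases "t \<in> bounce_times")
  case True
  then show ?thesis using reflects_at_bounce by (simp add: reflects_at_def)
next
  case False
  then obtain n \<sigma> C where "\<sigma> \<in> {1, -1}" "follows (nhds t) n \<sigma> C" by (rule follows_off_bounces)
  then have "hamilton_eq_at orbit orbit_momentum t" using follows_hamilton(2) by blast
  then show ?thesis unfolding hamilton_eq_at_def using has_vector_derivative_continuous by blast
qed

lemma finite_bounce_times: "finite (bounce_times \<inter> {a..b})"
proof (rule finite_subset[OF _ int_multiples_finite[OF w_pos, of a b]])
  have "of_int k * L = of_int (k * (4 * int c)) * w" for k by (simp add: L_eq)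
  then show "bounce_times \<inter> {a..b} \<subseteq> {t. \<exists>k::int. t = of_int k * w} \<inter> {a..b}"
    by (auto simp: bounce_times_def simp del: of_int_mult of_int_add)
qed

lemma periodic_orbit_orbit: "periodic_orbit (cyl_table d R H) orbit bounce_times"
proof -
  have "t \<notin> bounce_times \<Longrightarrow> orbit_momentum t \<in> unit_covectors (orbit t) \<and> hamilton_eq_at orbit orbit_momentum t" for t
    by (erule follows_off_bounces) (simp only: follows_hamilton simp_thms)
  then have "billiard_trajectory (cyl_table d R H) orbit bounce_times"
    unfolding billiard_trajectory_def
    using finite_bounce_times orbit_in_table reflects_at_bounce isCont_orbit
    by (intro conjI exI[of _ orbit_momentum])
      (auto simp: reflects_at_def intro: continuous_at_imp_continuous_on)
  moreover have "0 < 2 * L" using L_pos by simp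
  ultimately show ?thesis unfolding periodic_orbit_def using orbit_periodic by blast
qed

section \<open>Counting the bounce points\<close>

definition corners :: "space set" where "corners = (\<lambda>n. piece n w) ` {0..<2 * int c}"

lemma orbit_bounce_times:
  "orbit ` bounce_times = insert ((2 * r, 0), 0) (insert ((2 * r, 0), H) corners)"
proof (intro equalityI subsetI)
  fix q assume "q \<in> orbit ` bounce_times"
  then obtain t where q: "q = orbit t" and "t \<in> bounce_times" by blast
  from this(2) show "q \<in> insert ((2 * r, 0), 0) (insert ((2 * r, 0), H) corners)"
    by (cases rule: bounce_times_cases)
      (auto simp: q corners_def orbit_bottom orbit_top orbit_corner_forward orbit_corner_backward)
next
  fix q assume "q \<in> insert ((2 * r, 0), 0) (insert ((2 * r, 0), H) corners)"
  then consider "q = ((2 * r, 0), 0)" | "q = ((2 * r, 0), H)"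
    | n where "0 \<le> n" "n < 2 * int c" "q = piece n w" by (auto simp: corners_def)
  then show "q \<in> orbit ` bounce_times"
  proof cases
    case 1
    then show ?thesis using orbit_bottom[of 0] bounce_timesI(1)[of 0] by (intro image_eqI[of _ _ 0]) simp_all
  next
    case 2
    then show ?thesis using orbit_top[of 0] bounce_timesI(1)[of 1] by (intro image_eqI[of _ _ L]) simp_all
  next
    case 3
    then show ?thesis using orbit_corner_forward[of n 0] bounce_timesI(2)[of n]
      by (intro image_eqI[of _ _ "(2 * of_int n + 1) * w"]) simp_all
  qed
qed

text \<open>The sign of the y-coordinate reveals the parity of \<open>n\<close>. For equal parity
  the rises agree, so equal heights force equal multiples of \<open>h\<close>.\<close>

lemma card_corners: "card corners = 2 * c"
proof -
  have "inj_on (\<lambda>n. piece n w) {0..<2 * int c}"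
  proof (rule inj_onI)
    fix m n assume eq: "piece m w = piece n w"
    then have "parity_sign m * R = parity_sign n * R" using fst_corner by (metis snd_conv)
    then have "parity_sign m = parity_sign n" using R_pos by simp
    moreover have "snd (piece m w) = snd (piece n w)" using eq by simp
    ultimately have "of_int m * h = of_int n * h" by (simp add: snd_piece rise_def)
    then show "m = n" using h_pos by simp
  qed
  then show ?thesis by (simp add: corners_def card_image)
qed

lemma corner_height_strict: "q \<in> corners \<Longrightarrow> 0 < snd q \<and> snd q < H"
  using corner_height by (auto simp: corners_def)

lemma corner_on_sphere: "q \<in> corners \<Longrightarrow> fst q \<in> sphere (d, 0) R"
proof -
  have sign: "\<bar>parity_sign n\<bar> = 1" for n by (simp add: parity_sign_def)
  then show "q \<in> corners \<Longrightarrow> fst q \<in> sphere (d, 0) R"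
    by (use R_pos in \<open>auto simp: corners_def fst_corner dist_Pair_Pair dist_real_def abs_mult sign\<close>)
qed

lemma gamma_is_periodic: "gamma_is_periodic_orbit d \<psi> c"
proof -
  let ?B = "((2 * r, 0), 0) :: space" and ?T = "((2 * r, 0), H) :: space"
  have fin: "finite corners" by (simp add: corners_def)
  have off: "(2 * r, 0) \<notin> sphere (d, 0 :: real) R" using pole_in_ball by simp
  have notin: "?B \<notin> corners" "?T \<notin> corners" "?B \<noteq> ?T"
    using corner_height_strict[of ?B] corner_height_strict[of ?T] H_pos by auto
  have "card (insert ?B (insert ?T corners)) = 2 + 2 * c"
    using fin notin by (simp add: card_corners)
  moreover have "{q \<in> insert ?B (insert ?T corners). snd q = H} = {?T}"
    using H_pos corner_height_strict by fastforce
  moreover have "{q \<in> insert ?B (insert ?T corners). snd q = 0} = {?B}"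
    using H_pos corner_height_strict by fastforce
  moreover have "{q \<in> insert ?B (insert ?T corners). fst q \<in> sphere (d, 0) R} = corners"
    using off corner_on_sphere by (auto simp del: mem_sphere)
  ultimately show ?thesis
    unfolding gamma_is_periodic_orbit_def Let_def disc_rad_eq bounded_area_eq
      H_def[symmetric] orbit_def[symmetric]
    using periodic_orbit_orbit
    by (intro exI[of _ bounce_times]) (simp only: orbit_bounce_times card_corners, simp)
qed

end

section \<open>Return to the parameters \<open>d\<close> and \<open>\<psi>\<close>\<close>

lemma bigon_table_arc_rad:
  assumes "0 < d" "0 < \<psi>" "\<psi> < pi / 2"
  shows "bigon_table (arc_rad d \<psi>) \<psi>" and "bigon_table.d (arc_rad d \<psi>) \<psi> = d"
proof -
  have c: "0 < cos \<psi>" using assms by (intro cos_gt_zero_pi) auto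
  then show t: "bigon_table (arc_rad d \<psi>) \<psi>"
    using assms by unfold_locales (auto simp: arc_rad_def)
  have "arc_rad d \<psi> * (1 + cos \<psi>) = d" using c by (simp add: arc_rad_def)
  then show "bigon_table.d (arc_rad d \<psi>) \<psi> = d"
    by (simp add: bigon_table.d_def[OF t] distrib_left)
qed

lemma gamma_is_periodic_orbitI:
  assumes "0 < d" "0 < c" "1063 / 1169 \<le> \<psi>" "\<psi> < pi / 2"
  shows "gamma_is_periodic_orbit d \<psi> c"
proof -
  have "0 < \<psi>" using assms(3) by simp
  note t = bigon_table_arc_rad[OF assms(1) this assms(4)]
  interpret bigon_table "arc_rad d \<psi>" \<psi> by (rule t)
  interpret clear_bigon_table "arc_rad d \<psi>" \<psi> c
    by unfold_locales
      (rule assms(2), erule left_arc_above_bottom[OF assms(3,4)], rule corner_above_bottom[OF assms(3,4)])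
  show ?thesis using gamma_is_periodic by (simp only: t)
qed

lemma (in bigon_table) bigon_geometry:
  "\<psi> = arccos ((d\<^sup>2 - (disc_rad d \<psi>)\<^sup>2) / (d\<^sup>2 + (disc_rad d \<psi>)\<^sup>2)) \<and> disc_rad d \<psi> < d \<and>
   arc_rad d \<psi> = ((disc_rad d \<psi>)\<^sup>2 + d\<^sup>2) / (2 * d) \<and>
   range (nu d \<psi>) \<subseteq> cball (d, 0) (disc_rad d \<psi>) \<and>
   hlift (nu d \<psi>) 0 0 = ((2 * arc_rad d \<psi>, 0), 0) \<and>
   hlift (nu d \<psi>) 0 (real c * lap d \<psi>) = ((2 * arc_rad d \<psi>, 0), bounded_area d \<psi> c)"
proof -
  have "0 \<le> real c * (4 * w)" using w_pos by simp
  then show ?thesis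
    unfolding disc_rad_eq arc_rad_eq lap_eq bounded_area_eq
    using psi_from_radii R_less_d r_from_radii nu_in_disc by (simp add: hlift_eq lift_0 lift_lap)
qed

theorem lemma5p34:
  shows "(\<forall>(d::real) (\<psi>::real) (c::nat). 0 < d \<longrightarrow> 0 < \<psi> \<longrightarrow> \<psi> < pi / 2 \<longrightarrow> 0 < c \<longrightarrow>
            (let r = arc_rad d \<psi>; R = disc_rad d \<psi> in
               \<psi> = arccos ((d\<^sup>2 - R\<^sup>2) / (d\<^sup>2 + R\<^sup>2)) \<and> R < d \<and> r = (R\<^sup>2 + d\<^sup>2) / (2 * d) \<and>
               range (nu d \<psi>) \<subseteq> cball (d, 0) R \<and>
               hlift (nu d \<psi>) 0 0 = ((2 * r, 0), 0) \<and>
               hlift (nu d \<psi>) 0 (real c * lap d \<psi>) = ((2 * r, 0), bounded_area d \<psi> c)))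
       \<and> (\<forall>(d::real) (c::nat). 0 < d \<longrightarrow> 0 < c \<longrightarrow>
            (\<forall>\<^sub>F \<psi> in at_left (pi / 2). gamma_is_periodic_orbit d \<psi> c))
       \<and> (\<exists>\<psi>0::real. \<bar>\<psi>0 - 0.909324\<bar> \<le> 0.0000005 \<and> \<bar>\<psi>0 / pi - 0.289447\<bar> \<le> 0.0000005 \<and>
            (\<forall>(d::real) (c::nat) (\<psi>::real). 0 < d \<longrightarrow> 0 < c \<longrightarrow> \<psi>0 \<le> \<psi> \<longrightarrow> \<psi> < pi / 2 \<longrightarrow>
               gamma_is_periodic_orbit d \<psi> c))"
proof (intro conjI allI impI)
  fix d \<psi> :: real and c :: nat
  assume "0 < d" "0 < \<psi>" "\<psi> < pi / 2"
  note t = bigon_table_arc_rad[OF this]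
  show "let r = arc_rad d \<psi>; R = disc_rad d \<psi> in
               \<psi> = arccos ((d\<^sup>2 - R\<^sup>2) / (d\<^sup>2 + R\<^sup>2)) \<and> R < d \<and> r = (R\<^sup>2 + d\<^sup>2) / (2 * d) \<and>
               range (nu d \<psi>) \<subseteq> cball (d, 0) R \<and>
               hlift (nu d \<psi>) 0 0 = ((2 * r, 0), 0) \<and>
               hlift (nu d \<psi>) 0 (real c * lap d \<psi>) = ((2 * r, 0), bounded_area d \<psi> c)"
    unfolding Let_def using bigon_table.bigon_geometry[OF t(1), of c] unfolding t(2) .
next
  fix d :: real and c :: nat
  assume dc: "0 < d" "0 < c"
  have "\<forall>\<^sub>F \<psi> in at_left (pi / 2). \<psi> \<in> {1063 / 1169<..<pi / 2}"
    using pi_bounds by (intro eventually_at_left_real) simp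
  then show "\<forall>\<^sub>F \<psi> in at_left (pi / 2). gamma_is_periodic_orbit d \<psi> c"
    by eventually_elim (use dc in \<open>auto intro: gamma_is_periodic_orbitI\<close>)
next
  \<comment> \<open>For this angle the tolerance leaves \<pi> a window from about 3.141586 to
    3.141597, which determines the accuracy of \<open>pi_bounds\<close>.\<close>
  have "\<bar>(1063 / 1169) / pi - 0.289447\<bar> \<le> (0.0000005 :: real)"
    unfolding abs_diff_le_iff pos_divide_le_eq[OF pi_gt_zero] pos_le_divide_eq[OF pi_gt_zero]
    using pi_bounds by simp
  then show "\<exists>\<psi>0::real. \<bar>\<psi>0 - 0.909324\<bar> \<le> 0.0000005 \<and> \<bar>\<psi>0 / pi - 0.289447\<bar> \<le> 0.0000005 \<and>
            (\<forall>(d::real) (c::nat) (\<psi>::real). 0 < d \<longrightarrow> 0 < c \<longrightarrow> \<psi>0 \<le> \<psi> \<longrightarrow> \<psi> < pi / 2 \<longrightarrow>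
               gamma_is_periodic_orbit d \<psi> c)"
    by (intro exI[of _ "1063 / 1169"] conjI allI impI gamma_is_periodic_orbitI) simp_all
qed

end
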